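(* For any fixed orthotropic, plane-stress $\mathbf E\in\{\mathbf E:\mathbf E^-\preceq\mathbf E\preceq\mathbf E^+\}$, let $\mathbf E^b$ denote its base orientation, so that its components satisfy $E^b_{1112}=E^b_{2212}=0$. For any strain $\varepsilon\in\mathbb S^{2\times2}$ with Frobenius norm $\sqrt2/2$ and $t=|\mathrm{Tr}(\varepsilon)|$, set $$E_{\max}(t;\mathbf E):=\max\{\langle\mathbf E\varepsilon,\varepsilon\rangle:\varepsilon\in\mathbb S^{2\times2},\ \|\varepsilon\|_F=\sqrt2/2,\ |\mathrm{Tr}(\varepsilon)|=t\}.$$ Then the minimal $v\in[0,1]$ for which the Hashin--Shtrikman upper bound $\langle\mathbf E\varepsilon,\varepsilon\rangle\le f^{HS}(\varepsilon;v)$ is active, i.e. $\langle\mathbf E\varepsilon,\varepsilon\rangle=f^{HS}(\varepsilon;v)$, depends on $\varepsilon$ only through $t$, and is obtained by replacing $\langle\mathbf E\varepsilon,\varepsilon\rangle$ with $E_{\max}(t;\mathbf E)$ in the three closed-form branches $\hat v_1,\hat v_2,\hat v_3$ given in the context, with the same branch-activation conditions evaluated at $\langle\mathbf E\varepsilon,\varepsilon\rangle=E_{\max}(t;\mathbf E)$. Moreover, with $\Xi:=E^b_{1111}-2E^b_{1122}+E^b_{2222}-4E^b_{1212}$, $E_{\max}(t;\mathbf E)$ admits the explicit form $$E_{\max}(t;\mathbf E)=\frac{t^2}4\big(E^b_{1111}+2E^b_{1122}+E^b_{2222}\big)+E^b_{1212}(1-t^2)-\frac{t^2(E^b_{1111}-E^b_{2222})^2}{4\Xi}$$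 if $\Xi<0$ and $t\le\dfrac{|\Xi|}{\sqrt{\Xi^2+(E^b_{1111}-E^b_{2222})^2}}$, and otherwise $$E_{\max}(t;\mathbf E)=\frac14\big(E^b_{1111}-2E^b_{1122}+E^b_{2222}\big)+E^b_{1122}t^2+\frac{|E^b_{1111}-E^b_{2222}|}2\,t\sqrt{1-t^2}.$$
   Context: $\mathbb S^{2\times2}$ is the space of real symmetric $2\times2$ matrices with the Frobenius inner product $\langle\cdot,\cdot\rangle$; elasticity tensors $\mathbf E$ are fourth-order tensors (with minor and major symmetries) acting as self-adjoint linear maps on $\mathbb S^{2\times2}$; $\preceq$ is the Loewner order. The two isotropic phases are $\mathbf E^\pm\varepsilon=\kappa^\pm\mathrm{Tr}(\varepsilon)I+2\mu^\pm(\varepsilon-\tfrac12\mathrm{Tr}(\varepsilon)I)$ with $0<\kappa^-<\kappa^+$, $0<\mu^-<\mu^+$; $\Delta\kappa=\kappa^+-\kappa^-$, $\Delta\mu=\mu^+-\mu^-$. A tensor is orthotropic if in some orthonormal basis of $\mathbb R^2$ (its base coordinate system) its components satisfy $E_{1112}=E_{2212}=0$; $\mathbf E^b$ is the representation of $\mathbf E$ in that basis. For $\|\varepsilon\|_F=\sqrt2/2$, $t=|\mathrm{Tr}(\varepsilon)|\in[0,1]$ and $v\in[0,1]$ (volume fraction of the stiff phase $\mathbf E^+$): $f^{HS}(\varepsilon;v)=\langle[(1-v)\mathbf E^-+v\mathbf E^+]\varepsilon,\varepsilon\rangle-q(t;v)$ with $q(t;v)=\dfrac{v(1-v)(\Delta\kappa\,t-\Delta\mu\sqrt{1-t^2})^2}{\kappa^++\mu^+-(\Delta\kappa+\Delta\mu)v}$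 if $v t\Delta\kappa\le(\kappa^++\mu^+-\Delta\kappa v)\sqrt{1-t^2}$ and $v\Delta\mu\sqrt{1-t^2}\le(\kappa^++\mu^+-\Delta\mu v)t$; $q(t;v)=(1-v)\Big[\dfrac{v t^2\Delta\kappa^2}{\kappa^++\mu^+-\Delta\kappa v}-(1-t^2)\Delta\mu\Big]$ if $v t\Delta\kappa>(\kappa^++\mu^+-\Delta\kappa v)\sqrt{1-t^2}$; $q(t;v)=(1-v)\Big[\dfrac{v\Delta\mu^2(1-t^2)}{\kappa^++\mu^+-\Delta\mu v}-t^2\Delta\kappa\Big]$ if $v\Delta\mu\sqrt{1-t^2}>(\kappa^++\mu^+-\Delta\mu v)t$. The three closed-form branches and their activation conditions are: $\hat v_1=\dfrac12+\dfrac{\langle\mathbf E\varepsilon,\varepsilon\rangle(\Delta\mu+\Delta\kappa)+(2t^2-1)(\Delta\kappa\mu^+-\Delta\mu\kappa^+)-\sqrt D}{2\Delta\mu\Delta\kappa(t+\sqrt{1-t^2})^2}$, used if $\hat v_1\le\dfrac{\kappa^++\mu^+}{t+\sqrt{1-t^2}}\min\Big\{\dfrac{\sqrt{1-t^2}}{\Delta\kappa},\dfrac{t}{\Delta\mu}\Big\}$; $\hat v_2=\dfrac{\kappa^++\mu^+}{\Delta\kappa}\Big[1-\dfrac{t^2(\kappa^-+\mu^+)}{\langle\mathbf E\varepsilon,\varepsilon\rangle-\mu^+(1-2t^2)}\Big]$, used if $\hat v_2>\dfrac{(\kappa^++\mu^+)\sqrt{1-t^2}}{\Delta\kappa(t+\sqrt{1-t^2})}$;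 $\hat v_3=\dfrac{\kappa^++\mu^+}{\Delta\mu}\Big[1-\dfrac{(1-t^2)(\kappa^++\mu^-)}{\langle\mathbf E\varepsilon,\varepsilon\rangle+\kappa^+(1-2t^2)}\Big]$, used if $\hat v_3>\dfrac{(\kappa^++\mu^+)t}{\Delta\mu(t+\sqrt{1-t^2})}$; where $$D=\big[\langle\mathbf E\varepsilon,\varepsilon\rangle(\Delta\mu+\Delta\kappa)+(1-2t^2)(\Delta\mu\kappa^+-\Delta\kappa\mu^+)+\Delta\mu\Delta\kappa(\sqrt{1-t^2}+t)^2\big]^2-4\Delta\mu\Delta\kappa(\kappa^++\mu^+)(\sqrt{1-t^2}+t)^2\big(\langle\mathbf E\varepsilon,\varepsilon\rangle+(t^2-1)\mu^--t^2\kappa^-\big).$$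
   Formalization: "Active" at level t is read as: the bound holds for all normalized strains with |Tr ε| = t, with equality for one; the single-strain equality is claimed only for strains attaining E_max. Branches 2 and 3 additionally require v̂₂ ≤ 1, v̂₃ ≤ 1. The literal claims are false. *)

theory Defs
  imports "HOL-Analysis.Analysis"
begin

section \<open>Strains and elasticity tensors\<close>

text \<open>The inner product and norm of the library type \<^typ>\<open>real^2^2\<close> are the Frobenius inner product
  and the Frobenius norm.\<close>

type_synonym strain = "real^2^2"
type_synonym tensor4 = "real^2^2^2^2"

definition symmetric :: "strain \<Rightarrow> bool" where
  "symmetric \<epsilon> \<longleftrightarrow> transpose \<epsilon> = \<epsilon>"

definition elasticity_tensor :: "tensor4 \<Rightarrow> bool" where
  "elasticity_tensor E \<longleftrightarrow>
     (\<forall>i j k l. E$i$j$k$l = E$j$i$k$l \<and> E$i$j$k$l = E$i$j$l$k \<and> E$i$j$k$l = E$k$l$i$j)"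

definition tensor_apply :: "tensor4 \<Rightarrow> strain \<Rightarrow> strain" where
  "tensor_apply E \<epsilon> = (\<chi> i j. \<Sum>k\<in>UNIV. \<Sum>l\<in>UNIV. E$i$j$k$l * \<epsilon>$k$l)"

definition energy :: "tensor4 \<Rightarrow> strain \<Rightarrow> real" where
  "energy E \<epsilon> = tensor_apply E \<epsilon> \<bullet> \<epsilon>"

definition loewner_le :: "tensor4 \<Rightarrow> tensor4 \<Rightarrow> bool"  (infix "\<preceq>" 50) where
  "E \<preceq> F \<longleftrightarrow> (\<forall>\<epsilon>. symmetric \<epsilon> \<longrightarrow> energy E \<epsilon> \<le> energy F \<epsilon>)"

text \<open>Components of the isotropic tensor with bulk modulus \<open>\<kappa>\<close> and shear modulus \<open>\<mu>\<close>; the defining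
  action on symmetric strains is lemma \<open>iso_tensor_apply\<close>.\<close>

definition iso_tensor :: "real \<Rightarrow> real \<Rightarrow> tensor4" where
  "iso_tensor \<kappa> \<mu> = (\<chi> i j k l.
     \<kappa> * of_bool (i = j \<and> k = l)
     + 2 * \<mu> * ((of_bool (i = k \<and> j = l) + of_bool (i = l \<and> j = k)) / 2
                 - of_bool (i = j \<and> k = l) / 2))"

lemma iso_tensor_component:
  "iso_tensor \<kappa> \<mu> $i$j$k$l = (if i = j \<and> k = l then \<kappa> - \<mu> else 0)
     + (if i = k \<and> j = l then \<mu> else 0) + (if i = l \<and> j = k then \<mu> else 0)"
proof -
  have "\<kappa> * of_bool P + 2 * \<mu> * ((of_bool Q + of_bool R) / 2 - of_bool P / 2) =
      (if P then \<kappa> - \<mu> else 0) + (if Q then \<mu> else 0) + (if R then \<mu> else 0)" for P Q R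
    by (cases P; cases Q; cases R) (simp_all add: field_simps)
  then show ?thesis
    by (simp only: iso_tensor_def vec_lambda_beta)
qed

lemma iso_tensor_apply:
  assumes "symmetric \<epsilon>"
  shows "tensor_apply (iso_tensor \<kappa> \<mu>) \<epsilon> =
    (\<kappa> * trace \<epsilon>) *\<^sub>R mat 1 + (2 * \<mu>) *\<^sub>R (\<epsilon> - (trace \<epsilon> / 2) *\<^sub>R mat 1)"
proof -
  have "transpose \<epsilon> $1$2 = \<epsilon>$1$2"
    using assms by (simp only: symmetric_def)
  then have sym: "\<epsilon>$2$1 = \<epsilon>$1$2"
    by (simp only: transpose_def vec_lambda_beta)
  have ne: "((1::2) = 2) = False" "((2::2) = 1) = False"
    by simp_all
  show ?thesis
    unfolding vec_eq_iff forall_2 tensor_apply_def vec_lambda_beta sum_2 iso_tensor_component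
      vector_add_component vector_minus_component vector_scaleR_component mat_def trace_def
      real_scaleR_def sym ne simp_thms if_True if_False
    by (intro conjI) algebra+
qed

lemma elasticity_iso_tensor: "elasticity_tensor (iso_tensor \<kappa> \<mu>)"
proof -
  have ne: "((1::2) = 2) = False" "((2::2) = 1) = False"
    by simp_all
  show ?thesis
    unfolding elasticity_tensor_def forall_2 iso_tensor_component ne simp_thms if_True if_False
    by simp
qed

text \<open>Components in the coordinate system whose basis vectors are the columns of \<open>Q\<close>.\<close>

definition in_basis :: "real^2^2 \<Rightarrow> tensor4 \<Rightarrow> tensor4" where
  "in_basis Q E = (\<chi> i j k l. \<Sum>p\<in>UNIV. \<Sum>q\<in>UNIV. \<Sum>r\<in>UNIV. \<Sum>s\<in>UNIV.
     Q$p$i * Q$q$j * Q$r$k * Q$s$l * E$p$q$r$s)"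

definition base_coordinates :: "tensor4 \<Rightarrow> real^2^2 \<Rightarrow> bool" where
  "base_coordinates E Q \<longleftrightarrow>
     orthogonal_matrix Q \<and> in_basis Q E $1$1$1$2 = 0 \<and> in_basis Q E $2$2$1$2 = 0"

definition orthotropic :: "tensor4 \<Rightarrow> bool" where
  "orthotropic E \<longleftrightarrow> (\<exists>Q. base_coordinates E Q)"

section \<open>Normalized strains with prescribed absolute trace\<close>

definition normalized_strains :: "real \<Rightarrow> strain set" where
  "normalized_strains t = {\<epsilon>. symmetric \<epsilon> \<and> norm \<epsilon> = sqrt 2 / 2 \<and> \<bar>trace \<epsilon>\<bar> = t}"

definition E_max :: "real \<Rightarrow> tensor4 \<Rightarrow> real" where
  "E_max t E = (GREATEST e. e \<in> energy E ` normalized_strains t)"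

section \<open>The Hashin--Shtrikman upper bound\<close>

text \<open>The moduli of the weak phase are \<open>\<kappa>m\<close>, \<open>\<mu>m\<close>, those of the stiff phase \<open>\<kappa>p\<close>, \<open>\<mu>p\<close>.
  For \<open>v \<in> {0..1}\<close> the two inequalities tested below cannot fail simultaneously,
  so the order of the last two cases is immaterial.\<close>

definition q_HS :: "real \<Rightarrow> real \<Rightarrow> real \<Rightarrow> real \<Rightarrow> real \<Rightarrow> real \<Rightarrow> real" where
  "q_HS \<kappa>m \<kappa>p \<mu>m \<mu>p t v =
    (let \<Delta>\<kappa> = \<kappa>p - \<kappa>m; \<Delta>\<mu> = \<mu>p - \<mu>m; s = sqrt (1 - t\<^sup>2) in
     if v * t * \<Delta>\<kappa> \<le> (\<kappa>p + \<mu>p - \<Delta>\<kappa> * v) * s \<and> v * \<Delta>\<mu> * s \<le> (\<kappa>p + \<mu>p - \<Delta>\<mu> * v) * t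
     then v * (1 - v) * (\<Delta>\<kappa> * t - \<Delta>\<mu> * s)\<^sup>2 / (\<kappa>p + \<mu>p - (\<Delta>\<kappa> + \<Delta>\<mu>) * v)
     else if v * t * \<Delta>\<kappa> > (\<kappa>p + \<mu>p - \<Delta>\<kappa> * v) * s
     then (1 - v) * (v * t\<^sup>2 * \<Delta>\<kappa>\<^sup>2 / (\<kappa>p + \<mu>p - \<Delta>\<kappa> * v) - (1 - t\<^sup>2) * \<Delta>\<mu>)
     else (1 - v) * (v * \<Delta>\<mu>\<^sup>2 * (1 - t\<^sup>2) / (\<kappa>p + \<mu>p - \<Delta>\<mu> * v) - t\<^sup>2 * \<Delta>\<kappa>))"

definition f_HS :: "real \<Rightarrow> real \<Rightarrow> real \<Rightarrow> real \<Rightarrow> strain \<Rightarrow> real \<Rightarrow> real" where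
  "f_HS \<kappa>m \<kappa>p \<mu>m \<mu>p \<epsilon> v =
     energy ((1 - v) *\<^sub>R iso_tensor \<kappa>m \<mu>m + v *\<^sub>R iso_tensor \<kappa>p \<mu>p) \<epsilon>
     - q_HS \<kappa>m \<kappa>p \<mu>m \<mu>p \<bar>trace \<epsilon>\<bar> v"

text \<open>For an anisotropic \<open>E\<close> the energy of a single strain does not depend on the absolute trace
  \<open>t\<close> alone (for instance, pure shears in different directions all have \<open>t = 0\<close>), whereas the right-hand
  side of the bound does. The bound at level \<open>t\<close> is therefore the constraint imposed jointly by
  all normalized strains with absolute trace \<open>t\<close>; it is active when it holds for all of them,
  with equality for at least one.\<close>

definition HS_active ::
    "real \<Rightarrow> real \<Rightarrow> real \<Rightarrow> real \<Rightarrow> tensor4 \<Rightarrow> real \<Rightarrow> real \<Rightarrow> bool" where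
  "HS_active \<kappa>m \<kappa>p \<mu>m \<mu>p E t v \<longleftrightarrow>
     (\<forall>\<epsilon>\<in>normalized_strains t. energy E \<epsilon> \<le> f_HS \<kappa>m \<kappa>p \<mu>m \<mu>p \<epsilon> v) \<and>
     (\<exists>\<epsilon>\<in>normalized_strains t. energy E \<epsilon> = f_HS \<kappa>m \<kappa>p \<mu>m \<mu>p \<epsilon> v)"

definition is_minimum :: "real set \<Rightarrow> real \<Rightarrow> bool" where
  "is_minimum S m \<longleftrightarrow> m \<in> S \<and> (\<forall>x\<in>S. m \<le> x)"

definition is_maximum :: "real set \<Rightarrow> real \<Rightarrow> bool" where
  "is_maximum S m \<longleftrightarrow> m \<in> S \<and> (\<forall>x\<in>S. x \<le> m)"

section \<open>The closed-form branches\<close>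

text \<open>The argument \<open>e\<close> stands for the value of the energy.\<close>

definition D_HS :: "real \<Rightarrow> real \<Rightarrow> real \<Rightarrow> real \<Rightarrow> real \<Rightarrow> real \<Rightarrow> real" where
  "D_HS \<kappa>m \<kappa>p \<mu>m \<mu>p t e =
    (let \<Delta>\<kappa> = \<kappa>p - \<kappa>m; \<Delta>\<mu> = \<mu>p - \<mu>m; s = sqrt (1 - t\<^sup>2) in
     (e * (\<Delta>\<mu> + \<Delta>\<kappa>) + (1 - 2 * t\<^sup>2) * (\<Delta>\<mu> * \<kappa>p - \<Delta>\<kappa> * \<mu>p) + \<Delta>\<mu> * \<Delta>\<kappa> * (s + t)\<^sup>2)\<^sup>2
     - 4 * \<Delta>\<mu> * \<Delta>\<kappa> * (\<kappa>p + \<mu>p) * (s + t)\<^sup>2 * (e + (t\<^sup>2 - 1) * \<mu>m - t\<^sup>2 * \<kappa>m))"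

definition v1_HS :: "real \<Rightarrow> real \<Rightarrow> real \<Rightarrow> real \<Rightarrow> real \<Rightarrow> real \<Rightarrow> real" where
  "v1_HS \<kappa>m \<kappa>p \<mu>m \<mu>p t e =
    (let \<Delta>\<kappa> = \<kappa>p - \<kappa>m; \<Delta>\<mu> = \<mu>p - \<mu>m in
     1 / 2 + (e * (\<Delta>\<mu> + \<Delta>\<kappa>) + (2 * t\<^sup>2 - 1) * (\<Delta>\<kappa> * \<mu>p - \<Delta>\<mu> * \<kappa>p)
              - sqrt (D_HS \<kappa>m \<kappa>p \<mu>m \<mu>p t e))
             / (2 * \<Delta>\<mu> * \<Delta>\<kappa> * (t + sqrt (1 - t\<^sup>2))\<^sup>2))"

definition v2_HS :: "real \<Rightarrow> real \<Rightarrow> real \<Rightarrow> real \<Rightarrow> real \<Rightarrow> real \<Rightarrow> real" where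
  "v2_HS \<kappa>m \<kappa>p \<mu>m \<mu>p t e =
     (\<kappa>p + \<mu>p) / (\<kappa>p - \<kappa>m) * (1 - t\<^sup>2 * (\<kappa>m + \<mu>p) / (e - \<mu>p * (1 - 2 * t\<^sup>2)))"

definition v3_HS :: "real \<Rightarrow> real \<Rightarrow> real \<Rightarrow> real \<Rightarrow> real \<Rightarrow> real \<Rightarrow> real" where
  "v3_HS \<kappa>m \<kappa>p \<mu>m \<mu>p t e =
     (\<kappa>p + \<mu>p) / (\<mu>p - \<mu>m) * (1 - (1 - t\<^sup>2) * (\<kappa>p + \<mu>m) / (e + \<kappa>p * (1 - 2 * t\<^sup>2)))"

definition branch1 :: "real \<Rightarrow> real \<Rightarrow> real \<Rightarrow> real \<Rightarrow> real \<Rightarrow> real \<Rightarrow> bool" where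
  "branch1 \<kappa>m \<kappa>p \<mu>m \<mu>p t e \<longleftrightarrow>
     v1_HS \<kappa>m \<kappa>p \<mu>m \<mu>p t e \<le> (\<kappa>p + \<mu>p) / (t + sqrt (1 - t\<^sup>2))
        * min (sqrt (1 - t\<^sup>2) / (\<kappa>p - \<kappa>m)) (t / (\<mu>p - \<mu>m))"

text \<open>The values of \<^const>\<open>v2_HS\<close> and \<^const>\<open>v3_HS\<close> are candidates for a volume fraction only
  when they are at most \<open>1\<close>: if the inner denominator is nonpositive, they exceed \<open>1\<close> and the
  threshold inequality may hold although the bound is not in the corresponding regime.\<close>

definition branch2 :: "real \<Rightarrow> real \<Rightarrow> real \<Rightarrow> real \<Rightarrow> real \<Rightarrow> real \<Rightarrow> bool" where
  "branch2 \<kappa>m \<kappa>p \<mu>m \<mu>p t e \<longleftrightarrow>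
     v2_HS \<kappa>m \<kappa>p \<mu>m \<mu>p t e \<le> 1 \<and>
     v2_HS \<kappa>m \<kappa>p \<mu>m \<mu>p t e
       > (\<kappa>p + \<mu>p) * sqrt (1 - t\<^sup>2) / ((\<kappa>p - \<kappa>m) * (t + sqrt (1 - t\<^sup>2)))"

definition branch3 :: "real \<Rightarrow> real \<Rightarrow> real \<Rightarrow> real \<Rightarrow> real \<Rightarrow> real \<Rightarrow> bool" where
  "branch3 \<kappa>m \<kappa>p \<mu>m \<mu>p t e \<longleftrightarrow>
     v3_HS \<kappa>m \<kappa>p \<mu>m \<mu>p t e \<le> 1 \<and>
     v3_HS \<kappa>m \<kappa>p \<mu>m \<mu>p t e
       > (\<kappa>p + \<mu>p) * t / ((\<mu>p - \<mu>m) * (t + sqrt (1 - t\<^sup>2)))"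

end

theory Submission
  imports Defs
begin

text \<open>For strains with \<open>\<bar>tr \<epsilon>\<bar> = t\<close> the bound depends on \<open>\<epsilon>\<close> only through \<open>t\<close>, and its gap to
  the energy of the stiff phase is a strictly decreasing function of \<open>v\<close>: the formula of each regime
  is strictly decreasing, and the first exceeds each of the others by a multiple of a square that
  vanishes at the regime threshold. Hence the bound takes each energy between those of the two
  phases at exactly one \<open>v\<close>, which solves a quadratic or a linear equation, and the joint
  constraint imposed by all strains at level \<open>t\<close> is the one at the maximal energy. In base
  coordinates the energy at level \<open>t\<close> is a quadratic polynomial in \<open>\<epsilon>\<^sub>1\<^sub>1 - \<epsilon>\<^sub>2\<^sub>2\<close>, which ranges over
  the interval of radius \<open>sqrt (1 - t\<^sup>2)\<close>.\<close>

section \<open>The gap between the bound and the energy of the stiff phase\<close>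

text \<open>After cross-multiplying, the two sides differ by \<open>(K - c) * (w - u)\<close>, which
  is positive. This factor is common to the formulas of all three regimes.\<close>

lemma shifted_quotient_strict_antimono:
  fixes K c u w :: real
  assumes "0 \<le> c" "c < K" "u < w" "w \<le> 1"
  shows "(1 - w) / (K - c * w) < (1 - u) / (K - c * u)"
proof -
  have le: "c * x \<le> c" if "x \<le> 1" for x
    using mult_left_mono[OF that \<open>0 \<le> c\<close>] by simp
  have pos: "0 < K - c * w" "0 < K - c * u"
    using le[of w] le[of u] assms by simp_all
  have "0 < (K - c) * (w - u)" using assms by simp
  then have "(1 - w) * (K - c * u) < (1 - u) * (K - c * w)"
    by (simp add: algebra_simps)
  then show ?thesis using pos by (simp add: divide_simps)
qed

text \<open>Here \<open>a = \<Delta>\<kappa>\<close>, \<open>b = \<Delta>\<mu>\<close>, \<open>K = \<kappa>\<^sup>+ + \<mu>\<^sup>+\<close> and \<open>s = sqrt (1 - t\<^sup>2)\<close>. Exchanging \<open>a\<close> with \<open>b\<close> and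
  \<open>t\<close> with \<open>s\<close> exchanges the second and the third regime.\<close>

locale bound_gap =
  fixes a b K t s :: real
  assumes a: "0 < a" and b: "0 < b" and K: "a + b < K"
    and t: "0 \<le> t" and s: "0 \<le> s" and ts: "t\<^sup>2 + s\<^sup>2 = 1"
begin

text \<open>\<open>A\<close> is the energy of the stiff phase minus that of the weak phase at level
  \<open>t\<close>. A volume fraction \<open>v\<close> leaves the gap
  \<open>(1 - v) * A + q\<close>; \<open>gap1\<close> and \<open>gap2\<close> are this sum in the
  first two regimes, over a single denominator.\<close>

definition "A = a * t\<^sup>2 + b * s\<^sup>2"
definition "M = a * b * (s + t)\<^sup>2"
definition "gap1 v = (1 - v) * (A * K - v * M) / (K - (a + b) * v)"
definition "gap2 v = (1 - v) * (t\<^sup>2 * a * K) / (K - a * v)"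

text \<open>\<open>root1\<close> is the smaller root of the quadratic in \<open>v\<close> that
  \<open>gap1 v = x\<close> becomes; \<open>root2\<close> solves the equation
  \<open>gap2 v = x\<close>, which is linear in \<open>v\<close> once its denominator is
  cleared.\<close>

definition "root1 x = (A * K + M - x * (a + b)
    - sqrt ((A * K + M - x * (a + b))\<^sup>2 - 4 * M * K * (A - x))) / (2 * M)"
definition "root2 x = K / a * (1 - t\<^sup>2 * (K - a) / (t\<^sup>2 * K - x))"

lemma s_plus_t_pos: "0 < s + t"
proof -
  have "s \<noteq> 0 \<or> t \<noteq> 0" using ts by auto
  then show ?thesis using s t by linarith
qed

lemma A_pos: "0 < A"
proof -
  have "s \<noteq> 0 \<or> t \<noteq> 0" using ts by auto
  then show ?thesis unfolding A_def using a b
    by (auto intro: add_nonneg_pos add_pos_nonneg)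
qed

lemma M_pos: "0 < M"
  unfolding M_def using a b s_plus_t_pos by simp

lemma K_pos: "0 < K"
  using a b K by linarith

text \<open>Lagrange's identity. The remainder \<open>(a * t - b * s)^2\<close> is the square in the
  numerator of the first regime of \<open>q_HS\<close>.\<close>

lemma A_mult_sum: "A * (a + b) = M + (a * t - b * s)\<^sup>2"
  unfolding A_def M_def by algebra

lemma M_less: "M < A * K"
proof -
  have "M \<le> A * (a + b)" by (simp add: A_mult_sum)
  also have "\<dots> < A * K" using A_pos K by simp
  finally show ?thesis .
qed

lemma denominator_pos:
  assumes "v \<le> 1"
  shows "0 < K - (a + b) * v" "0 < K - a * v" "0 < K - b * v"
proof -
  have "(a + b) * v \<le> a + b" "a * v \<le> a" "b * v \<le> b"
    using mult_left_mono[OF assms, of "a + b"] mult_left_mono[OF assms, of a]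
      mult_left_mono[OF assms, of b] a b by simp_all
  then show "0 < K - (a + b) * v" "0 < K - a * v" "0 < K - b * v"
    using K a b by linarith+
qed

text \<open>Both factors decrease. The quotient may vanish at \<open>w = 1\<close>, so strictness is
  taken from the quotient, with the linear factor kept positive by \<open>M_less\<close>.\<close>

lemma gap1_strict_antimono:
  assumes "u < w" "w \<le> 1"
  shows "gap1 w < gap1 u"
proof -
  have q: "(1 - w) / (K - (a + b) * w) < (1 - u) / (K - (a + b) * u)"
    using assms a b K by (intro shifted_quotient_strict_antimono) auto
  have "w * M \<le> M" using assms M_pos by simp
  then have p: "0 < A * K - w * M" using M_less by linarith
  have "u * M < w * M" using assms M_pos by simp
  then have le: "A * K - w * M \<le> A * K - u * M" by simp
  have nn: "0 \<le> (1 - w) / (K - (a + b) * w)"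
    using assms denominator_pos(1)[of w] by simp
  have "gap1 w = (1 - w) / (K - (a + b) * w) * (A * K - w * M)"
    by (simp add: gap1_def)
  also have "\<dots> < (1 - u) / (K - (a + b) * u) * (A * K - w * M)"
    using q p by (rule mult_strict_right_mono)
  also have "\<dots> \<le> (1 - u) / (K - (a + b) * u) * (A * K - u * M)"
    using le nn q by (intro mult_left_mono) auto
  also have "\<dots> = gap1 u" by (simp add: gap1_def)
  finally show ?thesis .
qed

lemma gap2_strict_antimono:
  assumes "u < w" "w \<le> 1" "0 < t"
  shows "gap2 w < gap2 u"
proof -
  have "(1 - w) / (K - a * w) < (1 - u) / (K - a * u)"
    using assms a b K by (intro shifted_quotient_strict_antimono) auto
  moreover have "0 < t\<^sup>2 * a * K" using assms a K_pos by simp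
  ultimately have "(1 - w) / (K - a * w) * (t\<^sup>2 * a * K) < (1 - u) / (K - a * u) * (t\<^sup>2 * a * K)"
    by (rule mult_strict_right_mono)
  then show ?thesis by (simp add: gap2_def)
qed

text \<open>The square vanishes exactly at the threshold of the second regime, so the two formulas
  agree there, and its sign gives \<open>gap2_le_gap1\<close>.\<close>

lemma gap1_minus_gap2:
  assumes "v \<le> 1"
  shows "gap1 v - gap2 v =
    (1 - v) * (b * (K * s - v * a * (s + t))\<^sup>2) / ((K - (a + b) * v) * (K - a * v))"
proof -
  have "(A * K - v * M) * (K - a * v) - t\<^sup>2 * a * K * (K - (a + b) * v)
      = b * (K * s - v * a * (s + t))\<^sup>2"
    unfolding A_def M_def by algebra
  then have "(1 - v) * (A * K - v * M) * (K - a * v) - (1 - v) * (t\<^sup>2 * a * K) * (K - (a + b) * v)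
      = (1 - v) * (b * (K * s - v * a * (s + t))\<^sup>2)"
    by (simp add: mult.assoc flip: right_diff_distrib)
  then show ?thesis
    using denominator_pos[OF assms] unfolding gap1_def gap2_def by (simp add: diff_frac_eq)
qed

lemma gap2_le_gap1:
  assumes "v \<le> 1" shows "gap2 v \<le> gap1 v"
proof -
  have "0 \<le> (1 - v) * (b * (K * s - v * a * (s + t))\<^sup>2) / ((K - (a + b) * v) * (K - a * v))"
    using denominator_pos[OF assms] assms b
    by (intro divide_nonneg_pos mult_nonneg_nonneg mult_pos_pos) auto
  then show ?thesis using gap1_minus_gap2[OF assms] by linarith
qed

text \<open>At \<open>t = 0\<close> the formula \<open>gap2\<close> is constantly zero and
  monotonicity would fail; there the regime condition would force \<open>K < a * v\<close>.\<close>

lemma gap2_regime_pos: "v \<le> 1 \<Longrightarrow> K * s < v * a * (s + t) \<Longrightarrow> 0 < t"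
proof (rule ccontr)
  assume v: "v \<le> 1" and r: "K * s < v * a * (s + t)" and "\<not> 0 < t"
  then have "t = 0" using t by simp
  then have "0 < s" using s_plus_t_pos by simp
  have "0 < (K - a * v) * s" using denominator_pos(2)[OF v] \<open>0 < s\<close> by simp
  then show False using r \<open>t = 0\<close> by (simp add: algebra_simps)
qed

text \<open>If both thresholds were exceeded, adding the inequalities would give
  \<open>K < (a + b) * v\<close>.\<close>

lemma regimes_disjoint:
  assumes "v \<le> 1" "K * s < v * a * (s + t)" shows "v * b * (s + t) \<le> K * t"
proof -
  have "0 < (K - (a + b) * v) * (s + t)"
    using denominator_pos(1)[OF assms(1)] s_plus_t_pos by simp
  then show ?thesis using assms(2) by (simp add: algebra_simps)
qed

section \<open>Inverting the formulas of the first two regimes\<close>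

lemma root2_eq:
  assumes "v \<le> 1" "gap2 v = x" "0 < t"
  shows "root2 x = v"
proof -
  have d: "0 < K - a * v" using denominator_pos[OF assms(1)] by simp
  then have e: "x * (K - a * v) = (1 - v) * (t\<^sup>2 * a * K)"
    using assms(2) by (auto simp: gap2_def field_simps)
  \<comment> \<open>The product is positive, hence so is the denominator in \<open>root2\<close>,
    and the division is legitimate.\<close>
  have "(t\<^sup>2 * K - x) * (K - a * v) = t\<^sup>2 * K * (K - a)"
    using e by algebra
  moreover have "0 < t\<^sup>2 * K * (K - a)" using assms(3) K_pos K b by simp
  ultimately have "0 < (t\<^sup>2 * K - x) * (K - a * v)" by simp
  then have pos: "0 < t\<^sup>2 * K - x" using d by (simp add: zero_less_mult_iff)
  have "K * ((t\<^sup>2 * K - x) - t\<^sup>2 * (K - a)) = a * v * (t\<^sup>2 * K - x)"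
    using e by algebra
  then show ?thesis
    unfolding root2_def using pos a by (simp add: field_simps)
qed

lemma gap2_root2:
  assumes "root2 x \<le> 1"
  shows "gap2 (root2 x) = x"
proof -
  define v where "v = root2 x"
  have d: "0 < K - a * v" using denominator_pos assms v_def by simp
  \<comment> \<open>A nonpositive denominator makes the fraction nonpositive, also at zero because
    division by zero yields zero; then \<open>root2 x\<close> is at least \<open>K / a > 1\<close>,
    against the assumption.\<close>
  have "0 < t\<^sup>2 * K - x"
  proof (rule ccontr)
    assume "\<not> 0 < t\<^sup>2 * K - x"
    then have "t\<^sup>2 * (K - a) / (t\<^sup>2 * K - x) \<le> 0"
      using K b by (intro divide_nonneg_nonpos) auto
    then have "K / a * 1 \<le> K / a * (1 - t\<^sup>2 * (K - a) / (t\<^sup>2 * K - x))"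
      using K_pos a by (intro mult_left_mono) auto
    moreover have "1 < K / a" using K a b by simp
    ultimately show False using assms unfolding root2_def by simp
  qed
  then have "a * v * (t\<^sup>2 * K - x) = K * ((t\<^sup>2 * K - x) - t\<^sup>2 * (K - a))"
    unfolding v_def root2_def using a by (simp add: field_simps)
  then have "(1 - v) * (t\<^sup>2 * a * K) = x * (K - a * v)"
    by algebra
  then show ?thesis
    using d unfolding gap2_def v_def by (simp add: field_simps)
qed

lemma gap1_eq_iff:
  assumes "v \<le> 1"
  shows "gap1 v = x \<longleftrightarrow> M * v\<^sup>2 - (A * K + M - x * (a + b)) * v + K * (A - x) = 0"
proof -
  have "gap1 v = x \<longleftrightarrow> (1 - v) * (A * K - v * M) = x * (K - (a + b) * v)"
    using denominator_pos(1)[OF assms] by (auto simp: gap1_def field_simps)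
  also have "\<dots> \<longleftrightarrow> M * v\<^sup>2 - (A * K + M - x * (a + b)) * v + K * (A - x) = 0"
    by (simp add: algebra_simps power2_eq_square)
  finally show ?thesis .
qed

context
  fixes x :: real
  assumes x: "0 \<le> x" "x \<le> A"
begin

private definition "B = A * K + M - x * (a + b)"
private definition "d = B\<^sup>2 - 4 * M * K * (A - x)"

text \<open>The difference is \<open>-4 * M\<close> times the value of the quadratic at
  \<open>v = 1\<close>, and that value is \<open>- x * (K - (a + b))\<close>. Hence the roots are
  real and \<open>1\<close> lies between them.\<close>

private lemma discriminant: "(B - 2 * M)\<^sup>2 \<le> d"
proof -
  have "d - (B - 2 * M)\<^sup>2 = 4 * M * (x * (K - (a + b)))"
    unfolding d_def B_def by algebra
  moreover have "0 \<le> 4 * M * (x * (K - (a + b)))"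
    using M_pos x K by simp
  ultimately show ?thesis by linarith
qed

private lemma root1_alt: "2 * M * root1 x = B - sqrt d"
  unfolding root1_def d_def B_def using M_pos by simp

lemma root1_bounds: "0 \<le> root1 x" "root1 x \<le> 1"
proof -
  have "\<bar>B - 2 * M\<bar> \<le> sqrt d"
    using discriminant by (metis real_sqrt_abs real_sqrt_le_iff)
  then have "2 * M * root1 x \<le> 2 * M" using root1_alt by linarith
  then show "root1 x \<le> 1" using M_pos by simp
  \<comment> \<open>For the lower bound: \<open>B\<close> is nonnegative, and \<open>d\<close> is at
    most the square of \<open>B\<close> because the constant term of the quadratic is
    nonnegative.\<close>
  have "x * (a + b) \<le> A * K"
    using x a b K K_pos by (intro mult_mono) auto
  then have "0 \<le> B" unfolding B_def using M_pos by simp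
  moreover have "d \<le> B\<^sup>2" unfolding d_def using M_pos K_pos x by simp
  ultimately have "sqrt d \<le> B" using real_le_lsqrt by blast
  then have "0 \<le> 2 * M * root1 x" using root1_alt by linarith
  then show "0 \<le> root1 x" using M_pos by (simp add: zero_le_mult_iff)
qed

lemma gap1_root1: "gap1 (root1 x) = x"
proof -
  have "0 \<le> d" using discriminant by (meson order_trans zero_le_power2)
  then have "(B - 2 * M * root1 x)\<^sup>2 = d" using root1_alt by simp
  \<comment> \<open>Undoing the completion of the square recovers the quadratic of
    \<open>gap1_eq_iff\<close>.\<close>
  then have "4 * M * (M * (root1 x)\<^sup>2 - B * root1 x + K * (A - x)) = 0"
    unfolding d_def by algebra
  then show ?thesis
    using M_pos root1_bounds(2) by (simp add: gap1_eq_iff B_def)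
qed

end

text \<open>The quadratic has a second root; strict monotonicity of \<open>gap1\<close> up to
  \<open>1\<close> ensures that a solution there is the smaller one.\<close>

lemma root1_eq:
  assumes "v \<le> 1" "gap1 v = x" "0 \<le> x" "x \<le> A"
  shows "root1 x = v"
  using gap1_strict_antimono[of v "root1 x"] gap1_strict_antimono[of "root1 x" v] assms
    root1_bounds[of x] gap1_root1[of x]
  by (cases v "root1 x" rule: linorder_cases) auto

end

section \<open>Gluing the three regimes\<close>

context bound_gap
begin

interpretation swap: bound_gap b a K s t
  using a b K t s ts by unfold_locales auto

text \<open>Defining the third regime as the mirrored second one lets every lemma on
  \<open>gap2\<close> and \<open>root2\<close> transfer through \<open>swap\<close>.\<close>

definition "gap3 = bound_gap.gap2 b K s"
definition "root3 = bound_gap.root2 b K s"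

lemma swap_A: "swap.A = A" and swap_M: "swap.M = M"
  unfolding A_def M_def swap.A_def swap.M_def by (simp_all add: ac_simps)

lemma swap_gap1: "swap.gap1 = gap1"
  by (simp add: fun_eq_iff gap1_def swap.gap1_def swap_A swap_M add.commute)

text \<open>The regime tests are those of \<open>q_HS\<close> with all terms in \<open>v\<close>
  collected on the left, which makes it visible that a threshold once exceeded stays exceeded as
  \<open>v\<close> grows.\<close>

definition gap :: "real \<Rightarrow> real" where
  "gap v = (if v * a * (s + t) \<le> K * s \<and> v * b * (s + t) \<le> K * t then gap1 v
            else if v * a * (s + t) > K * s then gap2 v else gap3 v)"

text \<open>Besides the formula, each case records that the opposite threshold is respected and that
  \<open>t\<close> or \<open>s\<close> is positive, as strict monotonicity of \<open>gap2\<close> or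
  \<open>gap3\<close> requires.\<close>

lemma gap_cases:
  assumes "v \<le> 1"
  obtains (1) "v * a * (s + t) \<le> K * s" "v * b * (s + t) \<le> K * t" "gap v = gap1 v"
    | (2) "K * s < v * a * (s + t)" "v * b * (s + t) \<le> K * t" "0 < t" "gap v = gap2 v"
    | (3) "K * t < v * b * (s + t)" "v * a * (s + t) \<le> K * s" "0 < s" "gap v = gap3 v"
proof (cases "K * s < v * a * (s + t)")
  case True
  then show ?thesis
    using regimes_disjoint[OF assms] gap2_regime_pos[OF assms] by (intro 2) (auto simp: gap_def)
next
  case False
  note F = this
  show ?thesis
  proof (cases "K * t < v * b * (s + t)")
    case True
    then show ?thesis
      using swap.gap2_regime_pos[OF assms] F
      by (intro 3) (auto simp: gap_def add.commute)
  qed (use F in \<open>auto simp: gap_def intro: 1\<close>)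
qed

lemma gap_le_gap1: "v \<le> 1 \<Longrightarrow> gap v \<le> gap1 v"
  using gap2_le_gap1[of v] swap.gap2_le_gap1[of v]
  by (auto simp: gap_def gap3_def swap_gap1)

text \<open>If \<open>u\<close> is in the first regime, \<open>gap w\<close> is at most
  \<open>gap1 w\<close>, which is below \<open>gap1 u\<close>, whatever the regime of
  \<open>w\<close>. If \<open>u\<close> is in another regime, the larger \<open>w\<close> stays in
  it.\<close>

lemma gap_strict_antimono:
  assumes "u < w" "w \<le> 1"
  shows "gap w < gap u"
proof -
  have u: "u \<le> 1" using assms by simp
  have m: "u * a * (s + t) < w * a * (s + t)" "u * b * (s + t) < w * b * (s + t)"
    using assms(1) s_plus_t_pos a b by simp_all
  note mono = gap1_strict_antimono[OF assms] gap2_strict_antimono[OF assms]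
    swap.gap2_strict_antimono[OF assms, folded gap3_def]
  show ?thesis
  proof (cases rule: gap_cases[OF u])
    case 1
    then show ?thesis using gap_le_gap1[OF assms(2)] mono(1) by linarith
  next
    case 2
    then show ?thesis using mono(2) m
      by (cases rule: gap_cases[OF assms(2)]) auto
  next
    case 3
    then show ?thesis using mono(3) m
      by (cases rule: gap_cases[OF assms(2)]) auto
  qed
qed

lemma gap_eq_imp_eq:
  assumes "gap u = gap w" "u \<le> 1" "w \<le> 1"
  shows "u = w"
  using gap_strict_antimono[of u w] gap_strict_antimono[of w u] assms
  by (cases u w rule: linorder_cases) auto

text \<open>Intermediate value theorem for \<open>gap2\<close> between the threshold
  \<open>?c\<close>, where it equals \<open>gap1 ?c > x\<close>, and \<open>1\<close>, where it is
  zero. The point \<open>v\<close> beyond the threshold ensures \<open>?c < 1\<close>.\<close>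

lemma gap2_attains:
  assumes "0 \<le> x" "K * s < v * a * (s + t)" "v \<le> 1" "x < gap1 (K * s / (a * (s + t)))"
  shows "\<exists>w\<in>{0..1}. gap w = x"
proof -
  let ?c = "K * s / (a * (s + t))"
  have c: "0 \<le> ?c" "?c < 1"
  proof -
    have "?c < v" using assms(2) a s_plus_t_pos by (simp add: divide_less_eq ac_simps)
    then show "?c < 1" using assms(3) by simp
  qed (use K_pos s a s_plus_t_pos in simp)
  have "gap1 ?c - gap2 ?c = 0"
    using a s_plus_t_pos by (subst gap1_minus_gap2) (use c in simp_all)
  then have "x \<le> gap2 ?c" using assms(4) by simp
  moreover have "gap2 1 \<le> x" using assms(1) by (simp add: gap2_def)
  moreover have "continuous_on {?c..1} gap2"
    unfolding gap2_def using denominator_pos(2) by (intro continuous_intros) fastforce+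
  ultimately obtain w where w: "?c \<le> w" "w \<le> 1" "gap2 w = x"
    using IVT2'[of gap2 1 x ?c] c by auto
  \<comment> \<open>The second regime begins strictly after the threshold.\<close>
  have "w \<noteq> ?c" using w assms(4) \<open>gap1 ?c - gap2 ?c = 0\<close> by auto
  then have "?c < w" using w(1) by linarith
  then have "K * s < w * a * (s + t)"
    using a s_plus_t_pos by (simp add: divide_less_eq ac_simps)
  then have "gap w = x" using w(3) by (auto simp: gap_def)
  then show ?thesis using w c by (intro bexI[of _ w]) auto
qed

lemma gap_root1:
  assumes "0 \<le> x" "x \<le> A" "root1 x \<le> K / (s + t) * min (s / a) (t / b)"
  shows "gap (root1 x) = x"
proof -
  have "K / (s + t) * min (s / a) (t / b) \<le> K / (s + t) * (s / a)"
    "K / (s + t) * min (s / a) (t / b) \<le> K / (s + t) * (t / b)"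
    using K_pos s_plus_t_pos by (intro mult_left_mono; simp)+
  then have "root1 x \<le> K / (s + t) * (s / a)" "root1 x \<le> K / (s + t) * (t / b)"
    using assms(3) by linarith+
  then have "root1 x * a * (s + t) \<le> K * s" "root1 x * b * (s + t) \<le> K * t"
    using a b s_plus_t_pos by (simp_all add: le_divide_eq ac_simps)
  then show ?thesis using gap1_root1[OF assms(1,2)] by (simp add: gap_def)
qed

lemma gap_root2:
  assumes "root2 x \<le> 1" "K * s / (a * (s + t)) < root2 x"
  shows "gap (root2 x) = x"
proof -
  have "K * s < root2 x * a * (s + t)"
    using assms(2) a s_plus_t_pos by (simp add: divide_less_eq ac_simps)
  then show ?thesis using gap2_root2[OF assms(1)] by (simp add: gap_def)
qed

end

section \<open>Existence of a solution and choice of its branch\<close>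

context bound_gap
begin

text \<open>Interpreting anew makes the mirrored versions of \<open>gap\<close> and of its lemmas
  available too.\<close>

interpretation swap: bound_gap b a K s t
  using a b K t s ts by unfold_locales auto

text \<open>The two sides test the second and third regimes in opposite order, which is harmless
  because the regimes are disjoint.\<close>

lemma swap_gap:
  assumes "v \<le> 1" shows "swap.gap v = gap v"
proof -
  have "swap.gap3 = gap2" by (simp add: swap.gap3_def fun_eq_iff)
  then show ?thesis
    using regimes_disjoint[OF assms]
    by (auto simp: gap_def swap.gap_def gap3_def swap_gap1 add.commute)
qed

lemma gap1_root1_le:
  assumes "0 \<le> x" "x \<le> A" "c < root1 x"
  shows "x < gap1 c"
  using gap1_strict_antimono[OF assms(3)] root1_bounds(2)[OF assms(1,2)]
    gap1_root1[OF assms(1,2)] by simp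

text \<open>\<open>root1 x\<close> always lies in the unit interval. Either it respects both
  thresholds and is the solution, or it exceeds one, and then \<open>x\<close> is below
  \<open>gap1\<close> at that threshold and the other formula takes the value \<open>x\<close>
  beyond it.\<close>

lemma gap_attains:
  assumes "0 \<le> x" "x \<le> A"
  shows "\<exists>v\<in>{0..1}. gap v = x"
proof -
  let ?v = "root1 x"
  note bounds = root1_bounds[OF assms]
  consider "?v * a * (s + t) \<le> K * s" "?v * b * (s + t) \<le> K * t"
    | "K * s < ?v * a * (s + t)" | "K * t < ?v * b * (s + t)"
    by linarith
  then show ?thesis
  proof cases
    case 1
    then show ?thesis using bounds gap1_root1[OF assms]
      by (intro bexI[of _ ?v]) (auto simp: gap_def)
  next
    case 2
    have "K * s / (a * (s + t)) < ?v"
      using 2 a s_plus_t_pos by (simp add: divide_less_eq ac_simps)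
    then show ?thesis
      using gap2_attains[OF assms(1) 2] bounds gap1_root1_le[OF assms] by blast
  next
    case 3
    have "K * t / (b * (s + t)) < ?v"
      using 3 b s_plus_t_pos by (simp add: divide_less_eq ac_simps)
    then have "x < gap1 (K * t / (b * (s + t)))"
      using gap1_root1_le[OF assms] by blast
    then obtain w where w: "w \<in> {0..1}" "swap.gap w = x"
      using swap.gap2_attains[OF assms(1), of ?v] 3 bounds by (auto simp: swap_gap1 add.commute)
    then show ?thesis using swap_gap by auto
  qed
qed

lemma gap3_eq: "gap3 v = (1 - v) * (s\<^sup>2 * b * K) / (K - b * v)"
  by (simp add: gap3_def swap.gap2_def)

lemma root3_eq: "root3 x = K / b * (1 - s\<^sup>2 * (K - b) / (s\<^sup>2 * K - x))"
  by (simp add: root3_def swap.root2_def)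

lemma gap_root3:
  assumes "root3 x \<le> 1" "K * t / (b * (s + t)) < root3 x"
  shows "gap (root3 x) = x"
  using swap.gap_root2[of x] assms swap_gap[of "root3 x"]
  by (simp add: root3_def add.commute)

text \<open>The root belonging to the regime of the solution is the solution itself, so the branch
  test on that root is the regime test.\<close>

lemma gap_branches:
  assumes "gap v = x" "v \<le> 1" "0 \<le> x" "x \<le> A"
  shows "root1 x \<le> K / (s + t) * min (s / a) (t / b)
    \<or> root2 x \<le> 1 \<and> K * s / (a * (s + t)) < root2 x
    \<or> root3 x \<le> 1 \<and> K * t / (b * (s + t)) < root3 x"
proof (cases rule: gap_cases[OF assms(2)])
  case 1
  then have "root1 x = v" using root1_eq assms by simp
  moreover have "v \<le> K / (s + t) * (s / a)" "v \<le> K / (s + t) * (t / b)"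
    using 1 a b s_plus_t_pos by (simp_all add: le_divide_eq ac_simps)
  ultimately show ?thesis by (auto simp only: min_def split: if_split)
next
  case 2
  then have "root2 x = v" using root2_eq assms by simp
  moreover have "K * s / (a * (s + t)) < v"
    using 2 a s_plus_t_pos by (simp add: divide_less_eq ac_simps)
  ultimately show ?thesis using assms by simp
next
  case 3
  then have "root3 x = v" using swap.root2_eq assms by (simp add: root3_def gap3_def)
  moreover have "K * t / (b * (s + t)) < v"
    using 3 b s_plus_t_pos by (simp add: divide_less_eq ac_simps)
  ultimately show ?thesis using assms by simp
qed

end

section \<open>The energy on normalized strains\<close>

lemma energy_eq:
  "energy E \<epsilon> = (\<Sum>i\<in>UNIV. \<Sum>j\<in>UNIV. \<Sum>k\<in>UNIV. \<Sum>l\<in>UNIV. E$i$j$k$l * \<epsilon>$i$j * \<epsilon>$k$l)"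
  by (simp add: energy_def tensor_apply_def inner_vec_def sum_2 algebra_simps)

lemma energy_add: "energy (E + F) \<epsilon> = energy E \<epsilon> + energy F \<epsilon>"
  by (simp add: energy_eq distrib_right sum.distrib)

lemma energy_scaleR: "energy (c *\<^sub>R E) \<epsilon> = c * energy E \<epsilon>"
  by (simp add: energy_eq sum_distrib_left mult.assoc)

lemma symmetric_2: "symmetric \<epsilon> \<longleftrightarrow> \<epsilon>$2$1 = \<epsilon>$1$2"
  by (auto simp: symmetric_def transpose_def vec_eq_iff forall_2)

text \<open>Trace and determinant are invariant under orthogonal conjugation, so this form also
  yields invariance of the norm.\<close>

lemma norm_eq_trace_det:
  assumes "symmetric \<epsilon>"
  shows "norm \<epsilon> = sqrt ((trace \<epsilon>)\<^sup>2 - 2 * det \<epsilon>)"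
proof -
  have "\<epsilon> \<bullet> \<epsilon> = (trace \<epsilon>)\<^sup>2 - 2 * det \<epsilon>"
    using assms by (simp add: symmetric_2 inner_vec_def sum_2 trace_def det_2)
      (simp add: power2_eq_square algebra_simps)
  then show ?thesis by (simp add: norm_eq_sqrt_inner)
qed

lemma normalized_strains_iff:
  "\<epsilon> \<in> normalized_strains t \<longleftrightarrow> symmetric \<epsilon> \<and> \<bar>trace \<epsilon>\<bar> = t
    \<and> (\<epsilon>$1$1 - \<epsilon>$2$2)\<^sup>2 + (2 * \<epsilon>$1$2)\<^sup>2 = 1 - t\<^sup>2"
proof -
  have "norm \<epsilon> = sqrt 2 / 2 \<longleftrightarrow> (\<epsilon>$1$1 - \<epsilon>$2$2)\<^sup>2 + (2 * \<epsilon>$1$2)\<^sup>2 = 1 - (trace \<epsilon>)\<^sup>2"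
    if "symmetric \<epsilon>"
  proof -
    have "sqrt 2 / 2 = sqrt (1 / 2)"
      by (simp add: real_sqrt_divide real_div_sqrt field_simps)
    then have "norm \<epsilon> = sqrt 2 / 2 \<longleftrightarrow> (trace \<epsilon>)\<^sup>2 - 2 * det \<epsilon> = 1 / 2"
      using norm_eq_trace_det[OF that] by simp
    also have "\<dots> \<longleftrightarrow> (\<epsilon>$1$1 - \<epsilon>$2$2)\<^sup>2 + (2 * \<epsilon>$1$2)\<^sup>2 = 1 - (trace \<epsilon>)\<^sup>2"
      using that by (auto simp: symmetric_2 trace_def sum_2 det_2 power2_eq_square algebra_simps)
    finally show ?thesis .
  qed
  then show ?thesis by (auto simp: normalized_strains_def)
qed

lemma normalized_strains_trace_le: "\<epsilon> \<in> normalized_strains t \<Longrightarrow> t \<in> {0..1}"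
proof -
  assume e: "\<epsilon> \<in> normalized_strains t"
  then have "0 \<le> 1 - t\<^sup>2" by (metis normalized_strains_iff sum_power2_ge_zero)
  then show "t \<in> {0..1}" using e abs_le_square_iff[of t 1] by (auto simp: normalized_strains_def)
qed

lemma energy_iso_tensor:
  assumes "\<epsilon> \<in> normalized_strains t"
  shows "energy (iso_tensor \<kappa> \<mu>) \<epsilon> = \<kappa> * t\<^sup>2 + \<mu> * (1 - t\<^sup>2)"
proof -
  have ne: "((1::2) = 2) = False" "((2::2) = 1) = False"
    by simp_all
  have sym: "\<epsilon>$2$1 = \<epsilon>$1$2" and tr: "t\<^sup>2 = (\<epsilon>$1$1 + \<epsilon>$2$2)\<^sup>2"
    and nrm: "(\<epsilon>$1$1 - \<epsilon>$2$2)\<^sup>2 + (2 * \<epsilon>$1$2)\<^sup>2 = 1 - t\<^sup>2"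
    using assms by (auto simp: normalized_strains_iff symmetric_2 trace_def sum_2)
  have "energy (iso_tensor \<kappa> \<mu>) \<epsilon> =
      \<kappa> * (\<epsilon>$1$1 + \<epsilon>$2$2)\<^sup>2 + \<mu> * ((\<epsilon>$1$1 - \<epsilon>$2$2)\<^sup>2 + (2 * \<epsilon>$1$2)\<^sup>2)"
    unfolding energy_eq sum_2 iso_tensor_component ne simp_thms if_True if_False sym
    by algebra
  then show ?thesis by (simp only: tr[symmetric] nrm)
qed

section \<open>Invariance under change of basis\<close>

lemma energy_in_basis: "energy (in_basis Q E) \<epsilon> = energy E (Q ** \<epsilon> ** transpose Q)"
  unfolding energy_eq in_basis_def vec_lambda_beta matrix_matrix_mult_def transpose_def sum_2
  by algebra

lemma elasticity_tensor_2:
  assumes "elasticity_tensor E"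
  shows "E$2$1$i$j = E$1$2$i$j" "E$i$j$2$1 = E$i$j$1$2" "E$2$2$1$1 = E$1$1$2$2"
    "E$1$2$1$1 = E$1$1$1$2" "E$1$2$2$2 = E$2$2$1$2"
  using assms by (auto simp: elasticity_tensor_def)

lemma elasticity_in_basis:
  assumes "elasticity_tensor E"
  shows "elasticity_tensor (in_basis Q E)"
  unfolding elasticity_tensor_def forall_2 in_basis_def vec_lambda_beta sum_2
    elasticity_tensor_2[OF assms]
  by (simp add: algebra_simps)

lemma normalized_strains_conj:
  assumes "orthogonal_matrix Q" "\<epsilon> \<in> normalized_strains t"
  shows "Q ** \<epsilon> ** transpose Q \<in> normalized_strains t"
proof -
  let ?\<eta> = "Q ** \<epsilon> ** transpose Q"
  have Q: "transpose Q ** Q = mat 1" using assms(1) by (simp add: orthogonal_matrix_def)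
  have e: "symmetric \<epsilon>" "norm \<epsilon> = sqrt 2 / 2" "\<bar>trace \<epsilon>\<bar> = t"
    using assms(2) by (auto simp: normalized_strains_def)
  have sym: "symmetric ?\<eta>"
    using e(1) by (simp add: symmetric_def matrix_transpose_mul matrix_mul_assoc)
  have tr: "trace ?\<eta> = trace \<epsilon>"
    using trace_mul_sym[of "Q ** \<epsilon>" "transpose Q"]
    by (simp add: matrix_mul_assoc Q)
  have "det Q * det Q = 1"
    using arg_cong[OF Q, of det] by (simp add: det_mul)
  then have "det ?\<eta> = det \<epsilon>"
    by (simp add: det_mul)
  then show ?thesis
    using sym tr e by (simp add: normalized_strains_def norm_eq_trace_det)
qed

text \<open>Conjugation by \<open>Q\<close> permutes the strains at level \<open>t\<close>, with
  conjugation by the transpose as inverse. The maximum may therefore be computed in base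
  coordinates.\<close>

lemma energy_image_in_basis:
  assumes "orthogonal_matrix Q"
  shows "energy (in_basis Q E) ` normalized_strains t = energy E ` normalized_strains t"
proof (intro equalityI image_subsetI)
  fix \<epsilon> assume "\<epsilon> \<in> normalized_strains t"
  then show "energy (in_basis Q E) \<epsilon> \<in> energy E ` normalized_strains t"
    using normalized_strains_conj[OF assms] by (simp add: energy_in_basis)
next
  fix \<epsilon> assume e: "\<epsilon> \<in> normalized_strains t"
  have T: "orthogonal_matrix (transpose Q)" "Q ** transpose Q = mat 1"
    using assms by (simp_all add: orthogonal_matrix_def)
  have "Q ** (transpose Q ** \<epsilon> ** Q) ** transpose Q
      = (Q ** transpose Q) ** \<epsilon> ** (Q ** transpose Q)"
    by (simp only: matrix_mul_assoc)
  then have "energy E \<epsilon> = energy (in_basis Q E) (transpose Q ** \<epsilon> ** Q)"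
    by (simp add: energy_in_basis T)
  then show "energy E \<epsilon> \<in> energy (in_basis Q E) ` normalized_strains t"
    using normalized_strains_conj[OF T(1) e] by simp
qed

section \<open>The maximal energy in base coordinates\<close>

lemma energy_orthotropic:
  assumes "elasticity_tensor E" "E$1$1$1$2 = 0" "E$2$2$1$2 = 0" "\<epsilon> \<in> normalized_strains t"
  shows "energy E \<epsilon> = t\<^sup>2 / 4 * (E$1$1$1$1 + 2 * E$1$1$2$2 + E$2$2$2$2) + E$1$2$1$2 * (1 - t\<^sup>2)
    + (\<epsilon>$1$1 - \<epsilon>$2$2)\<^sup>2 / 4 * (E$1$1$1$1 - 2 * E$1$1$2$2 + E$2$2$2$2 - 4 * E$1$2$1$2)
    + trace \<epsilon> * (\<epsilon>$1$1 - \<epsilon>$2$2) / 2 * (E$1$1$1$1 - E$2$2$2$2)"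
proof -
  have sym: "\<epsilon>$2$1 = \<epsilon>$1$2" and tr: "t\<^sup>2 = (\<epsilon>$1$1 + \<epsilon>$2$2)\<^sup>2"
    and nrm: "1 - t\<^sup>2 = (\<epsilon>$1$1 - \<epsilon>$2$2)\<^sup>2 + (2 * \<epsilon>$1$2)\<^sup>2"
    using assms(4) by (auto simp: normalized_strains_iff symmetric_2 trace_def sum_2)
  \<comment> \<open>With the two coupling components zero, the shear entry enters only squared, and
    the normalization expresses that square through \<open>t\<close> and the difference of the
    diagonal entries.\<close>
  show ?thesis
    unfolding nrm unfolding energy_eq sum_2 trace_def elasticity_tensor_2[OF assms(1)] assms(2,3) sym tr
    by (simp add: field_simps power2_eq_square)
qed

lemma normalized_strain_exists:
  assumes "t \<in> {0..1}" "\<bar>d\<bar> \<le> sqrt (1 - t\<^sup>2)"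
  obtains \<epsilon> where "\<epsilon> \<in> normalized_strains t" "trace \<epsilon> = t" "\<epsilon>$1$1 - \<epsilon>$2$2 = d"
proof -
  \<comment> \<open>The off-diagonal entry is forced, up to sign, by the normalization.\<close>
  define c where "c = sqrt (1 - t\<^sup>2 - d\<^sup>2) / 2"
  define \<epsilon> :: strain where "\<epsilon> = vector [vector [(t + d) / 2, c], vector [c, (t - d) / 2]]"
  have "0 \<le> 1 - t\<^sup>2" using assms(1) by (simp add: power_le_one)
  then have "d\<^sup>2 \<le> 1 - t\<^sup>2"
    using power_mono[OF assms(2), of 2] by simp
  then have "(2 * c)\<^sup>2 = 1 - t\<^sup>2 - d\<^sup>2" by (simp add: c_def)
  then have "\<epsilon> \<in> normalized_strains t" "trace \<epsilon> = t" "\<epsilon>$1$1 - \<epsilon>$2$2 = d"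
    using assms(1)
    by (simp_all add: normalized_strains_iff symmetric_2 \<epsilon>_def trace_def sum_2 field_simps)
  then show thesis by (rule that)
qed

text \<open>A concave parabola with its vertex \<open>- t * X / \<Xi>\<close> inside the interval is
  maximal there; otherwise the maximum is at the endpoint whose sign matches
  \<open>X\<close>.\<close>

lemma is_maximum_quadratic:
  fixes \<Xi> X t s :: real
  assumes "0 \<le> t" "0 \<le> s" "t\<^sup>2 + s\<^sup>2 = 1"
  shows "is_maximum ((\<lambda>d. d\<^sup>2 / 4 * \<Xi> + t * d / 2 * X) ` {-s..s})
    (if \<Xi> < 0 \<and> t \<le> \<bar>\<Xi>\<bar> / sqrt (\<Xi>\<^sup>2 + X\<^sup>2) then - t\<^sup>2 * X\<^sup>2 / (4 * \<Xi>)
     else s\<^sup>2 / 4 * \<Xi> + t * s / 2 * \<bar>X\<bar>)"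
proof -
  \<comment> \<open>Squaring and inserting \<open>t^2 + s^2 = 1\<close> turns the bound on
    \<open>t\<close> into the condition that the vertex lies in the interval.\<close>
  have regime: "t \<le> \<bar>\<Xi>\<bar> / sqrt (\<Xi>\<^sup>2 + X\<^sup>2) \<longleftrightarrow> t * \<bar>X\<bar> \<le> s * \<bar>\<Xi>\<bar>" if "\<Xi> < 0"
  proof -
    have pos: "0 < \<Xi>\<^sup>2 + X\<^sup>2" using that by (intro add_pos_nonneg) auto
    have "t \<le> \<bar>\<Xi>\<bar> / sqrt (\<Xi>\<^sup>2 + X\<^sup>2) \<longleftrightarrow> t * sqrt (\<Xi>\<^sup>2 + X\<^sup>2) \<le> \<bar>\<Xi>\<bar>"
      using pos by (simp add: le_divide_eq)
    also have "\<dots> \<longleftrightarrow> (t * sqrt (\<Xi>\<^sup>2 + X\<^sup>2))\<^sup>2 \<le> \<bar>\<Xi>\<bar>\<^sup>2"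
      using assms(1) pos by (intro power_mono_iff[symmetric]) auto
    also have "\<dots> \<longleftrightarrow> t\<^sup>2 * (\<Xi>\<^sup>2 + X\<^sup>2) \<le> (t\<^sup>2 + s\<^sup>2) * \<Xi>\<^sup>2"
      using pos assms(3) by (simp add: power_mult_distrib)
    also have "\<dots> \<longleftrightarrow> (t * \<bar>X\<bar>)\<^sup>2 \<le> (s * \<bar>\<Xi>\<bar>)\<^sup>2"
      by (simp add: power_mult_distrib algebra_simps)
    also have "\<dots> \<longleftrightarrow> t * \<bar>X\<bar> \<le> s * \<bar>\<Xi>\<bar>"
      using assms(1,2) by (intro power_mono_iff) auto
    finally show ?thesis .
  qed
  show ?thesis
  proof (cases "\<Xi> < 0 \<and> t * \<bar>X\<bar> \<le> s * \<bar>\<Xi>\<bar>")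
    case True
    let ?d = "- (t * X / \<Xi>)"
    have "\<bar>?d\<bar> = t * \<bar>X\<bar> / \<bar>\<Xi>\<bar>"
      using assms(1) by (simp only: abs_minus_cancel abs_divide abs_mult abs_of_nonneg)
    also have "\<dots> \<le> s" using True by (subst pos_divide_le_eq) auto
    finally have d: "?d \<in> {-s..s}" unfolding abs_le_iff by auto
    have "- t\<^sup>2 * X\<^sup>2 / (4 * \<Xi>) - (d\<^sup>2 / 4 * \<Xi> + t * d / 2 * X) = (d * \<Xi> + t * X)\<^sup>2 / (4 * - \<Xi>)" for d
      using True by (simp add: field_simps power2_eq_square)
    moreover have "0 \<le> (d * \<Xi> + t * X)\<^sup>2 / (4 * - \<Xi>)" for d
      using True by (intro divide_nonneg_pos) auto
    ultimately have "d\<^sup>2 / 4 * \<Xi> + t * d / 2 * X \<le> - t\<^sup>2 * X\<^sup>2 / (4 * \<Xi>)" for d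
      by (metis diff_ge_0_iff_ge)
    moreover have "?d\<^sup>2 / 4 * \<Xi> + t * ?d / 2 * X = - t\<^sup>2 * X\<^sup>2 / (4 * \<Xi>)"
      using True by (simp add: field_simps power2_eq_square)
    ultimately show ?thesis
      using True regime d unfolding is_maximum_def
      by (auto intro!: image_eqI[of _ _ ?d])
  next
    case False
    let ?d = "if 0 \<le> X then s else - s"
    have "d\<^sup>2 / 4 * \<Xi> + t * d / 2 * X \<le> s\<^sup>2 / 4 * \<Xi> + t * s / 2 * \<bar>X\<bar>" if d: "d \<in> {-s..s}" for d
    proof -
      have d: "\<bar>d\<bar> \<le> s" using d by (simp add: abs_le_iff)
      \<comment> \<open>Up to the factor \<open>(s - \<bar>d\<bar>) / 4\<close>, this is the
        endpoint value minus the value at \<open>\<bar>d\<bar>\<close>, with \<open>X\<close>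
        replaced by \<open>\<bar>X\<bar>\<close>.\<close>
      have "0 \<le> (s + \<bar>d\<bar>) * \<Xi> + 2 * (t * \<bar>X\<bar>)"
      proof (cases "\<Xi> < 0")
        case True
        then have "- (s * \<Xi>) < t * \<bar>X\<bar>" using False by simp
        moreover have "s * \<Xi> \<le> \<bar>d\<bar> * \<Xi>" using d True by (intro mult_right_mono_neg) auto
        ultimately show ?thesis unfolding distrib_right by linarith
      qed (use assms in auto)
      then have "0 \<le> (s - \<bar>d\<bar>) * ((s + \<bar>d\<bar>) * \<Xi> + 2 * (t * \<bar>X\<bar>))"
        using d by simp
      also have "\<dots> = (s\<^sup>2 - \<bar>d\<bar>\<^sup>2) * \<Xi> + 2 * t * \<bar>X\<bar> * (s - \<bar>d\<bar>)"
        by algebra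
      finally have "d\<^sup>2 / 4 * \<Xi> + t * \<bar>d\<bar> / 2 * \<bar>X\<bar> \<le> s\<^sup>2 / 4 * \<Xi> + t * s / 2 * \<bar>X\<bar>"
        by (simp add: algebra_simps)
      moreover have "t * (d * X) \<le> t * (\<bar>d\<bar> * \<bar>X\<bar>)"
        using assms(1) by (intro mult_left_mono) (simp_all flip: abs_mult)
      ultimately show ?thesis by (simp add: algebra_simps)
    qed
    moreover have "?d\<^sup>2 / 4 * \<Xi> + t * ?d / 2 * X = s\<^sup>2 / 4 * \<Xi> + t * s / 2 * \<bar>X\<bar>"
      by simp
    moreover have "?d \<in> {-s..s}" using assms by simp
    ultimately show ?thesis
      using False regime unfolding is_maximum_def
      by (auto intro!: image_eqI[of _ _ ?d] simp del: if_image_distrib)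
  qed
qed

lemma E_max_eq: "is_maximum (energy E ` normalized_strains t) m \<Longrightarrow> E_max t E = m"
  unfolding E_max_def is_maximum_def by (intro Greatest_equality) auto

lemma is_maximum_add:
  fixes c :: real
  shows "is_maximum (g ` S) n \<Longrightarrow> is_maximum ((\<lambda>d. c + g d) ` S) (c + n)"
  by (auto simp: is_maximum_def)

lemma is_maximum_energy:
  assumes "elasticity_tensor E" "base_coordinates E Q" "t \<in> {0..1}"
  defines "Eb \<equiv> in_basis Q E"
  defines "\<Xi> \<equiv> Eb$1$1$1$1 - 2 * Eb$1$1$2$2 + Eb$2$2$2$2 - 4 * Eb$1$2$1$2"
  shows "is_maximum (energy E ` normalized_strains t)
          (if \<Xi> < 0 \<and> t \<le> \<bar>\<Xi>\<bar> / sqrt (\<Xi>\<^sup>2 + (Eb$1$1$1$1 - Eb$2$2$2$2)\<^sup>2)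
           then t\<^sup>2 / 4 * (Eb$1$1$1$1 + 2 * Eb$1$1$2$2 + Eb$2$2$2$2) + Eb$1$2$1$2 * (1 - t\<^sup>2)
                - t\<^sup>2 * (Eb$1$1$1$1 - Eb$2$2$2$2)\<^sup>2 / (4 * \<Xi>)
           else 1 / 4 * (Eb$1$1$1$1 - 2 * Eb$1$1$2$2 + Eb$2$2$2$2) + Eb$1$1$2$2 * t\<^sup>2
                + \<bar>Eb$1$1$1$1 - Eb$2$2$2$2\<bar> / 2 * t * sqrt (1 - t\<^sup>2))"
    (is "is_maximum _ ?m")
proof -
  define s where "s = sqrt (1 - t\<^sup>2)"
  define C where "C = t\<^sup>2 / 4 * (Eb$1$1$1$1 + 2 * Eb$1$1$2$2 + Eb$2$2$2$2) + Eb$1$2$1$2 * (1 - t\<^sup>2)"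
  define X where "X = Eb$1$1$1$1 - Eb$2$2$2$2"
  define g where "g d = d\<^sup>2 / 4 * \<Xi> + t * d / 2 * X" for d
  have s: "0 \<le> s" "s\<^sup>2 = 1 - t\<^sup>2"
    using assms(3) by (simp_all add: s_def power_le_one)
  have Q: "orthogonal_matrix Q" and Eb: "elasticity_tensor Eb" "Eb$1$1$1$2 = 0" "Eb$2$2$1$2 = 0"
    using assms(1,2) elasticity_in_basis by (auto simp: base_coordinates_def Eb_def)
  have en: "energy Eb \<epsilon> = C + ((\<epsilon>$1$1 - \<epsilon>$2$2)\<^sup>2 / 4 * \<Xi> + trace \<epsilon> * (\<epsilon>$1$1 - \<epsilon>$2$2) / 2 * X)"
    if "\<epsilon> \<in> normalized_strains t" for \<epsilon>
    using energy_orthotropic[OF Eb that] by (simp add: C_def \<Xi>_def X_def)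
  have image: "energy Eb ` normalized_strains t = (\<lambda>d. C + g d) ` {-s..s}"
  proof (intro equalityI image_subsetI)
    fix \<epsilon> assume e: "\<epsilon> \<in> normalized_strains t"
    let ?d = "\<epsilon>$1$1 - \<epsilon>$2$2"
    have "?d\<^sup>2 + (2 * \<epsilon>$1$2)\<^sup>2 = s\<^sup>2"
      using e s(2) by (simp only: normalized_strains_iff)
    then have "?d\<^sup>2 \<le> s\<^sup>2" using zero_le_power2[of "2 * \<epsilon>$1$2"] by linarith
    then have "\<bar>?d\<bar> \<le> s" using s(1) by (metis abs_le_square_iff abs_of_nonneg)
    then have d: "?d \<in> {-s..s}" "- ?d \<in> {-s..s}" by auto
    have "trace \<epsilon> = t \<or> trace \<epsilon> = - t" using e by (auto simp: normalized_strains_def)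
    then show "energy Eb \<epsilon> \<in> (\<lambda>d. C + g d) ` {-s..s}"
    proof
      assume "trace \<epsilon> = t"
      then have "energy Eb \<epsilon> = C + g ?d" using en[OF e] by (simp add: g_def)
      then show ?thesis using d(1) by blast
    next
      \<comment> \<open>Only the product of trace and diagonal difference has a sign, so trace
        \<open>- t\<close> amounts to trace \<open>t\<close> with the difference negated.\<close>
      assume "trace \<epsilon> = - t"
      then have "energy Eb \<epsilon> = C + g (- ?d)"
        using en[OF e] by (simp add: g_def del: minus_diff_eq)
      then show ?thesis using d(2) by blast
    qed
  next
    fix d assume "d \<in> {-s..s}"
    then have "\<bar>d\<bar> \<le> sqrt (1 - t\<^sup>2)" by (auto simp: s_def)
    then obtain \<epsilon> where "\<epsilon> \<in> normalized_strains t" "trace \<epsilon> = t" "\<epsilon>$1$1 - \<epsilon>$2$2 = d"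
      using normalized_strain_exists[OF assms(3)] by blast
    then show "C + g d \<in> energy Eb ` normalized_strains t"
      using en by (auto simp: g_def intro!: image_eqI[of _ _ \<epsilon>])
  qed
  have g_max: "is_maximum (g ` {-s..s})
    (if \<Xi> < 0 \<and> t \<le> \<bar>\<Xi>\<bar> / sqrt (\<Xi>\<^sup>2 + X\<^sup>2) then - t\<^sup>2 * X\<^sup>2 / (4 * \<Xi>)
     else s\<^sup>2 / 4 * \<Xi> + t * s / 2 * \<bar>X\<bar>)" (is "is_maximum _ ?n")
    unfolding g_def using assms(3) s by (intro is_maximum_quadratic) auto
  have value_eq: "?m = C + ?n"
  proof -
    have boundary: "1 / 4 * (Eb$1$1$1$1 - 2 * Eb$1$1$2$2 + Eb$2$2$2$2) + Eb$1$1$2$2 * t\<^sup>2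
        = C + s\<^sup>2 / 4 * \<Xi>"
      unfolding s(2) C_def \<Xi>_def by (simp add: field_simps)
    show ?thesis
      unfolding X_def[symmetric] C_def[symmetric] s_def[symmetric] boundary
      by (auto simp: ac_simps)
  qed
  have "is_maximum (energy Eb ` normalized_strains t) ?m"
    unfolding image value_eq by (rule is_maximum_add[OF g_max])
  then show ?thesis by (simp add: Eb_def energy_image_in_basis[OF Q])
qed

section \<open>The minimal volume fraction\<close>

text \<open>The mixture has energy \<open>(1 - v) * A\<close> below the stiff phase. In the second
  and third regimes the subtracted term in \<open>q_HS\<close> cancels one of the two summands of
  \<open>A\<close>.\<close>

lemma f_HS_eq_gap:
  fixes \<kappa>m \<kappa>p \<mu>m \<mu>p t :: real
  assumes "0 < \<kappa>m" "\<kappa>m < \<kappa>p" "0 < \<mu>m" "\<mu>m < \<mu>p" "\<epsilon> \<in> normalized_strains t" "v \<le> 1"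
  defines "a \<equiv> \<kappa>p - \<kappa>m" and "b \<equiv> \<mu>p - \<mu>m" and "K \<equiv> \<kappa>p + \<mu>p" and "s \<equiv> sqrt (1 - t\<^sup>2)"
  shows "f_HS \<kappa>m \<kappa>p \<mu>m \<mu>p \<epsilon> v = \<kappa>p * t\<^sup>2 + \<mu>p * (1 - t\<^sup>2) - bound_gap.gap a b K t s v"
proof -
  have t: "0 \<le> t" "t \<le> 1" using normalized_strains_trace_le[OF assms(5)] by auto
  have s_sq: "0 \<le> s" "s\<^sup>2 = 1 - t\<^sup>2" using t by (simp_all add: s_def power_le_one)
  interpret bound_gap a b K t s
    using assms(1-4) t s_sq by unfold_locales (auto simp: a_def b_def K_def)
  note den = denominator_pos[OF assms(6)]
  have c2: "v * t * a \<le> (K - a * v) * s \<longleftrightarrow> v * a * (s + t) \<le> K * s"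
    and c3: "v * b * s \<le> (K - b * v) * t \<longleftrightarrow> v * b * (s + t) \<le> K * t"
    by (simp_all add: algebra_simps)
  have q1: "(1 - v) * A + v * (1 - v) * (a * t - b * s)\<^sup>2 / (K - (a + b) * v) = gap1 v"
  proof -
    have "(1 - v) * A * (K - (a + b) * v) + v * (1 - v) * (a * t - b * s)\<^sup>2 = (1 - v) * (A * K - v * M)"
      unfolding A_def M_def by algebra
    then show ?thesis using den(1) by (simp add: gap1_def field_simps)
  qed
  have q2: "(1 - v) * A + (1 - v) * (v * t\<^sup>2 * a\<^sup>2 / (K - a * v) - s\<^sup>2 * b) = gap2 v"
    using den(2) by (simp add: gap2_def A_def field_simps power2_eq_square)
  have q3: "(1 - v) * A + (1 - v) * (v * b\<^sup>2 * s\<^sup>2 / (K - b * v) - t\<^sup>2 * a) = gap3 v"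
    using den(3) by (simp add: gap3_eq A_def field_simps power2_eq_square)
  have "(1 - v) * A + q_HS \<kappa>m \<kappa>p \<mu>m \<mu>p t v = gap v"
    unfolding q_HS_def Let_def a_def[symmetric] b_def[symmetric] K_def[symmetric] s_def[symmetric]
      c2 c3 not_le[symmetric] gap_def
    unfolding s_sq(2)[symmetric]
    using q1 q2 q3 by simp
  moreover have "energy ((1 - v) *\<^sub>R iso_tensor \<kappa>m \<mu>m + v *\<^sub>R iso_tensor \<kappa>p \<mu>p) \<epsilon>
      = \<kappa>p * t\<^sup>2 + \<mu>p * (1 - t\<^sup>2) - (1 - v) * A"
    unfolding energy_add energy_scaleR energy_iso_tensor[OF assms(5)] A_def unfolding a_def b_def s_sq(2)
    by algebra
  moreover have "\<bar>trace \<epsilon>\<bar> = t" using assms(5) by (simp add: normalized_strains_def)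
  ultimately show ?thesis by (simp add: f_HS_def)
qed

text \<open>Substituting \<open>x = ep - e\<close> turns the coefficients of the two kinds of
  equations into the closed forms; the summand \<open>1 / 2\<close> of \<open>v1_HS\<close> is
  \<open>M / (2 * M)\<close>.\<close>

lemma HS_roots:
  fixes \<kappa>m \<kappa>p \<mu>m \<mu>p t e :: real
  assumes "0 < \<kappa>m" "\<kappa>m < \<kappa>p" "0 < \<mu>m" "\<mu>m < \<mu>p" "t \<in> {0..1}"
  defines "a \<equiv> \<kappa>p - \<kappa>m" and "b \<equiv> \<mu>p - \<mu>m" and "K \<equiv> \<kappa>p + \<mu>p" and "s \<equiv> sqrt (1 - t\<^sup>2)"
    and "ep \<equiv> \<kappa>p * t\<^sup>2 + \<mu>p * (1 - t\<^sup>2)"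
  shows "bound_gap a b K t s"
    and "v1_HS \<kappa>m \<kappa>p \<mu>m \<mu>p t e = bound_gap.root1 a b K t s (ep - e)"
    and "v2_HS \<kappa>m \<kappa>p \<mu>m \<mu>p t e = bound_gap.root2 a K t (ep - e)"
    and "v3_HS \<kappa>m \<kappa>p \<mu>m \<mu>p t e = bound_gap.root3 b K s (ep - e)"
proof -
  have t: "0 \<le> t" "t \<le> 1" using assms(5) by auto
  have s_sq: "0 \<le> s" "s\<^sup>2 = 1 - t\<^sup>2" using t by (simp_all add: s_def power_le_one)
  interpret bound_gap a b K t s
    using assms(1-4) t s_sq by unfold_locales (auto simp: a_def b_def K_def)
  show "bound_gap a b K t s" ..
  have lin: "A * K - (ep - e) * (a + b) = e * (b + a) + (2 * t\<^sup>2 - 1) * (a * \<mu>p - b * \<kappa>p)"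
    unfolding A_def unfolding ep_def s_sq(2) a_def b_def K_def by algebra
  have "A - (ep - e) = e + (t\<^sup>2 - 1) * \<mu>m - t\<^sup>2 * \<kappa>m"
    unfolding A_def unfolding ep_def s_sq(2) a_def b_def by algebra
  then have D: "D_HS \<kappa>m \<kappa>p \<mu>m \<mu>p t e = (A * K + M - (ep - e) * (a + b))\<^sup>2 - 4 * M * K * (A - (ep - e))"
    unfolding D_HS_def Let_def M_def a_def[symmetric] b_def[symmetric] K_def[symmetric] s_def[symmetric]
    using lin[unfolded M_def] by algebra
  have M2: "2 * b * a * (t + s)\<^sup>2 = 2 * M" by (simp add: M_def ac_simps)
  have "v1_HS \<kappa>m \<kappa>p \<mu>m \<mu>p t e = 1 / 2 + (A * K - (ep - e) * (a + b) - sqrt (D_HS \<kappa>m \<kappa>p \<mu>m \<mu>p t e)) / (2 * M)"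
    unfolding v1_HS_def Let_def a_def[symmetric] b_def[symmetric] s_def[symmetric] M2 lin ..
  then show "v1_HS \<kappa>m \<kappa>p \<mu>m \<mu>p t e = root1 (ep - e)"
    unfolding D root1_def using M_pos by (simp add: field_simps)
  have "t\<^sup>2 * K - (ep - e) = e - \<mu>p * (1 - 2 * t\<^sup>2)" "K - a = \<kappa>m + \<mu>p"
    by (simp_all add: K_def ep_def a_def algebra_simps)
  then show "v2_HS \<kappa>m \<kappa>p \<mu>m \<mu>p t e = root2 (ep - e)"
    by (simp add: v2_HS_def root2_def flip: a_def K_def)
  have "s\<^sup>2 * K - (ep - e) = e + \<kappa>p * (1 - 2 * t\<^sup>2)" "K - b = \<kappa>p + \<mu>m"
    by (simp_all add: K_def ep_def b_def s_sq(2) algebra_simps)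
  then show "v3_HS \<kappa>m \<kappa>p \<mu>m \<mu>p t e = root3 (ep - e)"
    by (simp add: v3_HS_def root3_eq s_sq(2) flip: b_def K_def)
qed

lemma HS_minimal_fraction:
  fixes \<kappa>m \<kappa>p \<mu>m \<mu>p t :: real
  assumes moduli: "0 < \<kappa>m" "\<kappa>m < \<kappa>p" "0 < \<mu>m" "\<mu>m < \<mu>p"
    and between: "iso_tensor \<kappa>m \<mu>m \<preceq> E" "E \<preceq> iso_tensor \<kappa>p \<mu>p"
    and max: "is_maximum (energy E ` normalized_strains t) e"
  shows "\<exists>v. is_minimum {v\<in>{0..1}. HS_active \<kappa>m \<kappa>p \<mu>m \<mu>p E t v} v \<and>
    (\<forall>\<epsilon>\<in>normalized_strains t. energy E \<epsilon> = e \<longrightarrow>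
       is_minimum {v\<in>{0..1}. energy E \<epsilon> = f_HS \<kappa>m \<kappa>p \<mu>m \<mu>p \<epsilon> v} v) \<and>
    (branch1 \<kappa>m \<kappa>p \<mu>m \<mu>p t e \<or> branch2 \<kappa>m \<kappa>p \<mu>m \<mu>p t e \<or> branch3 \<kappa>m \<kappa>p \<mu>m \<mu>p t e) \<and>
    (branch1 \<kappa>m \<kappa>p \<mu>m \<mu>p t e \<longrightarrow> v = v1_HS \<kappa>m \<kappa>p \<mu>m \<mu>p t e) \<and>
    (branch2 \<kappa>m \<kappa>p \<mu>m \<mu>p t e \<longrightarrow> v = v2_HS \<kappa>m \<kappa>p \<mu>m \<mu>p t e) \<and>
    (branch3 \<kappa>m \<kappa>p \<mu>m \<mu>p t e \<longrightarrow> v = v3_HS \<kappa>m \<kappa>p \<mu>m \<mu>p t e)"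
proof -
  define a where "a = \<kappa>p - \<kappa>m"
  define b where "b = \<mu>p - \<mu>m"
  define K where "K = \<kappa>p + \<mu>p"
  define s where "s = sqrt (1 - t\<^sup>2)"
  define ep where "ep = \<kappa>p * t\<^sup>2 + \<mu>p * (1 - t\<^sup>2)"
  note folds = a_def[symmetric] b_def[symmetric] K_def[symmetric] s_def[symmetric] ep_def[symmetric]
  obtain \<epsilon>0 where \<epsilon>0: "\<epsilon>0 \<in> normalized_strains t" "energy E \<epsilon>0 = e"
    using max by (auto simp: is_maximum_def)
  have le: "energy E \<epsilon> \<le> e" if "\<epsilon> \<in> normalized_strains t" for \<epsilon>
    using max that by (auto simp: is_maximum_def)
  have t: "t \<in> {0..1}" using normalized_strains_trace_le \<epsilon>0(1) .
  note roots = HS_roots[OF moduli t, unfolded folds]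
  interpret bound_gap a b K t s by (rule roots(1))
  have f: "f_HS \<kappa>m \<kappa>p \<mu>m \<mu>p \<epsilon> v = ep - gap v" if "\<epsilon> \<in> normalized_strains t" "v \<le> 1" for \<epsilon> v
    using f_HS_eq_gap[OF moduli that] unfolding folds .
  \<comment> \<open>The Loewner bounds at a maximizing strain place \<open>ep - e\<close> between
    \<open>0\<close> and \<open>A\<close>, the range in which \<open>gap\<close> is
    solvable.\<close>
  have iso: "energy (iso_tensor \<kappa>m \<mu>m) \<epsilon>0 \<le> e" "e \<le> energy (iso_tensor \<kappa>p \<mu>p) \<epsilon>0"
    using between \<epsilon>0 by (auto simp: loewner_le_def normalized_strains_def)
  have "s\<^sup>2 = 1 - t\<^sup>2" using ts by simp
  then have "A = ep - (\<kappa>m * t\<^sup>2 + \<mu>m * (1 - t\<^sup>2))"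
    unfolding A_def unfolding ep_def a_def b_def by algebra
  then have x: "0 \<le> ep - e" "ep - e \<le> A"
    using iso energy_iso_tensor[OF \<epsilon>0(1)] by (simp_all add: ep_def)
  then obtain v where v: "0 \<le> v" "v \<le> 1" "gap v = ep - e"
    using gap_attains[OF x] by auto
  have unique: "w = v" if "w \<le> 1" "gap w = ep - e" for w
    using gap_eq_imp_eq[of w v] that v by simp
  \<comment> \<open>The bound is the same number for all strains at level \<open>t\<close>. Validity
    at a maximizer makes it at least \<open>e\<close>, and equality at some strain makes it at most
    \<open>e\<close>.\<close>
  have active: "HS_active \<kappa>m \<kappa>p \<mu>m \<mu>p E t w \<longleftrightarrow> gap w = ep - e" if w: "w \<le> 1" for w
  proof
    assume "HS_active \<kappa>m \<kappa>p \<mu>m \<mu>p E t w"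
    then obtain \<epsilon> where "\<epsilon> \<in> normalized_strains t" "energy E \<epsilon> = ep - gap w" "e \<le> ep - gap w"
      using f[OF _ w] \<epsilon>0 unfolding HS_active_def by metis
    then show "gap w = ep - e" using le[of \<epsilon>] by simp
  next
    assume "gap w = ep - e"
    then show "HS_active \<kappa>m \<kappa>p \<mu>m \<mu>p E t w"
      using f[OF _ w] \<epsilon>0 le unfolding HS_active_def by auto
  qed
  have b1: "branch1 \<kappa>m \<kappa>p \<mu>m \<mu>p t e \<longleftrightarrow> root1 (ep - e) \<le> K / (s + t) * min (s / a) (t / b)"
    and b2: "branch2 \<kappa>m \<kappa>p \<mu>m \<mu>p t e \<longleftrightarrow> root2 (ep - e) \<le> 1 \<and> K * s / (a * (s + t)) < root2 (ep - e)"
    and b3: "branch3 \<kappa>m \<kappa>p \<mu>m \<mu>p t e \<longleftrightarrow> root3 (ep - e) \<le> 1 \<and> K * t / (b * (s + t)) < root3 (ep - e)"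
    unfolding branch1_def branch2_def branch3_def roots(2-4) folds add.commute[of t s] by (rule refl)+
  show ?thesis
  proof (rule exI[of _ v], intro conjI ballI impI)
    \<comment> \<open>Uniqueness makes the set of active fractions a singleton, so its minimum is
      the solution, and every branch whose test holds must return it.\<close>
    have "{v\<in>{0..1}. HS_active \<kappa>m \<kappa>p \<mu>m \<mu>p E t v} = {v}"
      using v by (auto simp: active intro!: unique)
    then show "is_minimum {v\<in>{0..1}. HS_active \<kappa>m \<kappa>p \<mu>m \<mu>p E t v} v"
      by (simp add: is_minimum_def)
    show "is_minimum {v\<in>{0..1}. energy E \<epsilon> = f_HS \<kappa>m \<kappa>p \<mu>m \<mu>p \<epsilon> v} v"
      if \<epsilon>: "\<epsilon> \<in> normalized_strains t" "energy E \<epsilon> = e" for \<epsilon>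
    proof -
      have eq: "energy E \<epsilon> = f_HS \<kappa>m \<kappa>p \<mu>m \<mu>p \<epsilon> w \<longleftrightarrow> gap w = ep - e" if "w \<le> 1" for w
        using f[OF \<epsilon>(1) that] \<epsilon>(2) by auto
      have "{v\<in>{0..1}. energy E \<epsilon> = f_HS \<kappa>m \<kappa>p \<mu>m \<mu>p \<epsilon> v} = {v}"
        using v by (auto simp: eq intro!: unique)
      then show ?thesis by (simp add: is_minimum_def)
    qed
    show "branch1 \<kappa>m \<kappa>p \<mu>m \<mu>p t e \<or> branch2 \<kappa>m \<kappa>p \<mu>m \<mu>p t e \<or> branch3 \<kappa>m \<kappa>p \<mu>m \<mu>p t e"
      unfolding b1 b2 b3 using gap_branches[OF v(3,2) x] .
    show "v = v1_HS \<kappa>m \<kappa>p \<mu>m \<mu>p t e" if "branch1 \<kappa>m \<kappa>p \<mu>m \<mu>p t e"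
      using unique[OF root1_bounds(2)[OF x]] gap_root1[OF x] that unfolding b1 roots(2) by simp
    show "v = v2_HS \<kappa>m \<kappa>p \<mu>m \<mu>p t e" if "branch2 \<kappa>m \<kappa>p \<mu>m \<mu>p t e"
      using unique[of "root2 (ep - e)"] gap_root2[of "ep - e"] that unfolding b2 roots(3) by simp
    show "v = v3_HS \<kappa>m \<kappa>p \<mu>m \<mu>p t e" if "branch3 \<kappa>m \<kappa>p \<mu>m \<mu>p t e"
      using unique[of "root3 (ep - e)"] gap_root3[of "ep - e"] that unfolding b3 roots(4) by simp
  qed
qed

theorem proposition3p6:
  fixes E :: tensor4 and \<kappa>m \<kappa>p \<mu>m \<mu>p :: real
  assumes "0 < \<kappa>m" "\<kappa>m < \<kappa>p" "0 < \<mu>m" "\<mu>m < \<mu>p"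
    and "elasticity_tensor E" and "orthotropic E"
    and "iso_tensor \<kappa>m \<mu>m \<preceq> E" and "E \<preceq> iso_tensor \<kappa>p \<mu>p"
  shows
    "(\<forall>t\<in>{0..1}. is_maximum (energy E ` normalized_strains t) (E_max t E)) \<and>
     (\<exists>vmin :: real \<Rightarrow> real. \<forall>\<epsilon>. symmetric \<epsilon> \<and> norm \<epsilon> = sqrt 2 / 2 \<longrightarrow>
       (let t = \<bar>trace \<epsilon>\<bar>; e = E_max t E in
          is_minimum {v\<in>{0..1}. HS_active \<kappa>m \<kappa>p \<mu>m \<mu>p E t v} (vmin t) \<and>
          (energy E \<epsilon> = e \<longrightarrow>
             is_minimum {v\<in>{0..1}. energy E \<epsilon> = f_HS \<kappa>m \<kappa>p \<mu>m \<mu>p \<epsilon> v} (vmin t)) \<and>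
          (branch1 \<kappa>m \<kappa>p \<mu>m \<mu>p t e \<or> branch2 \<kappa>m \<kappa>p \<mu>m \<mu>p t e \<or> branch3 \<kappa>m \<kappa>p \<mu>m \<mu>p t e) \<and>
          (branch1 \<kappa>m \<kappa>p \<mu>m \<mu>p t e \<longrightarrow> vmin t = v1_HS \<kappa>m \<kappa>p \<mu>m \<mu>p t e) \<and>
          (branch2 \<kappa>m \<kappa>p \<mu>m \<mu>p t e \<longrightarrow> vmin t = v2_HS \<kappa>m \<kappa>p \<mu>m \<mu>p t e) \<and>
          (branch3 \<kappa>m \<kappa>p \<mu>m \<mu>p t e \<longrightarrow> vmin t = v3_HS \<kappa>m \<kappa>p \<mu>m \<mu>p t e))) \<and>
     (\<forall>Q. base_coordinates E Q \<longrightarrow> (\<forall>t\<in>{0..1}.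
       (let Eb = in_basis Q E;
            \<Xi> = Eb$1$1$1$1 - 2 * Eb$1$1$2$2 + Eb$2$2$2$2 - 4 * Eb$1$2$1$2 in
        E_max t E =
          (if \<Xi> < 0 \<and> t \<le> \<bar>\<Xi>\<bar> / sqrt (\<Xi>\<^sup>2 + (Eb$1$1$1$1 - Eb$2$2$2$2)\<^sup>2)
           then t\<^sup>2 / 4 * (Eb$1$1$1$1 + 2 * Eb$1$1$2$2 + Eb$2$2$2$2) + Eb$1$2$1$2 * (1 - t\<^sup>2)
                - t\<^sup>2 * (Eb$1$1$1$1 - Eb$2$2$2$2)\<^sup>2 / (4 * \<Xi>)
           else 1 / 4 * (Eb$1$1$1$1 - 2 * Eb$1$1$2$2 + Eb$2$2$2$2) + Eb$1$1$2$2 * t\<^sup>2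
                + \<bar>Eb$1$1$1$1 - Eb$2$2$2$2\<bar> / 2 * t * sqrt (1 - t\<^sup>2)))))"
  (is "?maximum \<and> ?minimum \<and> ?formula")
proof (intro conjI)
  obtain Q where Q: "base_coordinates E Q" using assms(6) by (auto simp: orthotropic_def)
  show max: ?maximum
  proof
    fix t :: real assume t: "t \<in> {0..1}"
    from is_maximum_energy[OF assms(5) Q t]
    show "is_maximum (energy E ` normalized_strains t) (E_max t E)"
      using E_max_eq by metis
  qed
  let ?P = "\<lambda>t v. is_minimum {v\<in>{0..1}. HS_active \<kappa>m \<kappa>p \<mu>m \<mu>p E t v} v \<and>
    (\<forall>\<epsilon>\<in>normalized_strains t. energy E \<epsilon> = E_max t E \<longrightarrow>
       is_minimum {v\<in>{0..1}. energy E \<epsilon> = f_HS \<kappa>m \<kappa>p \<mu>m \<mu>p \<epsilon> v} v) \<and>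
    (branch1 \<kappa>m \<kappa>p \<mu>m \<mu>p t (E_max t E) \<or> branch2 \<kappa>m \<kappa>p \<mu>m \<mu>p t (E_max t E)
      \<or> branch3 \<kappa>m \<kappa>p \<mu>m \<mu>p t (E_max t E)) \<and>
    (branch1 \<kappa>m \<kappa>p \<mu>m \<mu>p t (E_max t E) \<longrightarrow> v = v1_HS \<kappa>m \<kappa>p \<mu>m \<mu>p t (E_max t E)) \<and>
    (branch2 \<kappa>m \<kappa>p \<mu>m \<mu>p t (E_max t E) \<longrightarrow> v = v2_HS \<kappa>m \<kappa>p \<mu>m \<mu>p t (E_max t E)) \<and>
    (branch3 \<kappa>m \<kappa>p \<mu>m \<mu>p t (E_max t E) \<longrightarrow> v = v3_HS \<kappa>m \<kappa>p \<mu>m \<mu>p t (E_max t E))"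
  \<comment> \<open>The fraction is chosen for each \<open>t\<close> before any strain is fixed,
    which makes \<open>vmin\<close> a function of \<open>t\<close> alone.\<close>
  have "\<forall>t\<in>{0..1}. \<exists>v. ?P t v"
    by (intro ballI HS_minimal_fraction[OF assms(1-4,7,8)] bspec[OF max])
  then obtain vmin where vmin: "\<And>t. t \<in> {0..1} \<Longrightarrow> ?P t (vmin t)"
    using bchoice[of "{0..1}" ?P] by fast
  show ?minimum
  proof (intro exI[of _ vmin] allI impI, unfold Let_def)
    fix \<epsilon> :: strain assume e: "symmetric \<epsilon> \<and> norm \<epsilon> = sqrt 2 / 2"
    let ?t = "\<bar>trace \<epsilon>\<bar>"
    let ?e = "E_max ?t E"
    have \<epsilon>: "\<epsilon> \<in> normalized_strains ?t" using e by (simp add: normalized_strains_def)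
    from vmin[OF normalized_strains_trace_le[OF \<epsilon>]] \<epsilon>
    show "is_minimum {v\<in>{0..1}. HS_active \<kappa>m \<kappa>p \<mu>m \<mu>p E ?t v} (vmin ?t) \<and>
          (energy E \<epsilon> = ?e \<longrightarrow>
             is_minimum {v\<in>{0..1}. energy E \<epsilon> = f_HS \<kappa>m \<kappa>p \<mu>m \<mu>p \<epsilon> v} (vmin ?t)) \<and>
          (branch1 \<kappa>m \<kappa>p \<mu>m \<mu>p ?t ?e \<or> branch2 \<kappa>m \<kappa>p \<mu>m \<mu>p ?t ?e \<or> branch3 \<kappa>m \<kappa>p \<mu>m \<mu>p ?t ?e) \<and>
          (branch1 \<kappa>m \<kappa>p \<mu>m \<mu>p ?t ?e \<longrightarrow> vmin ?t = v1_HS \<kappa>m \<kappa>p \<mu>m \<mu>p ?t ?e) \<and>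
          (branch2 \<kappa>m \<kappa>p \<mu>m \<mu>p ?t ?e \<longrightarrow> vmin ?t = v2_HS \<kappa>m \<kappa>p \<mu>m \<mu>p ?t ?e) \<and>
          (branch3 \<kappa>m \<kappa>p \<mu>m \<mu>p ?t ?e \<longrightarrow> vmin ?t = v3_HS \<kappa>m \<kappa>p \<mu>m \<mu>p ?t ?e)"
      by blast
  qed
  show ?formula
    unfolding Let_def by (intro allI impI ballI E_max_eq is_maximum_energy[OF assms(5)])
qed

end
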